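(* For all $r\in\mathbb{R}$, $F_{\rm GOE}(r)^4<F^0_{\rm stat}(r)\,F_{\rm GUE}(r)$.
   Context: Let $u$ be the Hastings-McLeod solution of the Painlevé II equation $u_{xx}=2u^3+xu$, i.e. the unique solution with $u(x)\sim-\mathrm{Ai}(x)$ as $x\to\infty$ (so $u<0$ and $u'>0$ on $\mathbb{R}$). Define $$v(x)=-\int_x^\infty u(s)^2\,ds,\qquad y(x)=x+2u'(x)+2u(x)^2,\qquad F(x)=e^{\frac12\int_x^\infty v(s)\,ds},\qquad E(x)=e^{\frac12\int_x^\infty u(s)\,ds}.$$ The Tracy-Widom GUE and GOE distributions and the Baik-Rains distribution (with parameter $0$) are $$F_{\rm GUE}(x)=F(x)^2,\qquad F_{\rm GOE}(x)=F(x)E(x),\qquad F^0_{\rm stat}(x)=[1-y(x)v(x)]\,E(x)^4\,F_{\rm GUE}(x).$$ *)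

theory Defs
  imports "HOL-Analysis.Analysis" "HOL-Library.Landau_Symbols"
begin

text \<open>
  The integrand is not absolutely integrable.  The gauge integral over the half-line
  \<open>{0..}\<close> is the limit of the integrals over \<open>{0..R}\<close> as \<open>R\<close> tends to infinity, so this is the
  usual improper integral.
\<close>

definition Airy_Ai :: "real \<Rightarrow> real" where
  "Airy_Ai x = (1 / pi) * integral {0..} (\<lambda>t. cos (t ^ 3 / 3 + x * t))"

definition painleve_II :: "(real \<Rightarrow> real) \<Rightarrow> bool" where
  "painleve_II u \<longleftrightarrow>
     (\<forall>x. u field_differentiable (at x) \<and>
          (deriv u has_real_derivative (2 * u x ^ 3 + x * u x)) (at x))"

text \<open>
  There is exactly one such function on the whole real line; it is also negative and strictly
  increasing, but this is not part of the definition.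
\<close>

definition hastings_mcleod :: "(real \<Rightarrow> real) \<Rightarrow> bool" where
  "hastings_mcleod u \<longleftrightarrow> painleve_II u \<and> u \<sim>[at_top] (\<lambda>x. - Airy_Ai x)"

definition TW_v :: "(real \<Rightarrow> real) \<Rightarrow> real \<Rightarrow> real" where
  "TW_v u x = - integral {x..} (\<lambda>s. (u s)\<^sup>2)"

definition TW_y :: "(real \<Rightarrow> real) \<Rightarrow> real \<Rightarrow> real" where
  "TW_y u x = x + 2 * deriv u x + 2 * (u x)\<^sup>2"

definition TW_F :: "(real \<Rightarrow> real) \<Rightarrow> real \<Rightarrow> real" where
  "TW_F u x = exp (1 / 2 * integral {x..} (\<lambda>s. TW_v u s))"

definition TW_E :: "(real \<Rightarrow> real) \<Rightarrow> real \<Rightarrow> real" where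
  "TW_E u x = exp (1 / 2 * integral {x..} (\<lambda>s. u s))"

definition F_GUE :: "(real \<Rightarrow> real) \<Rightarrow> real \<Rightarrow> real" where
  "F_GUE u x = (TW_F u x)\<^sup>2"

definition F_GOE :: "(real \<Rightarrow> real) \<Rightarrow> real \<Rightarrow> real" where
  "F_GOE u x = TW_F u x * TW_E u x"

text \<open>The Baik--Rains distribution with parameter \<open>0\<close>.\<close>

definition F_stat0 :: "(real \<Rightarrow> real) \<Rightarrow> real \<Rightarrow> real" where
  "F_stat0 u x = (1 - TW_y u x * TW_v u x) * TW_E u x ^ 4 * F_GUE u x"

end

theory Submission
  imports Defs "HOL-Probability.Probability" "HOL-Complex_Analysis.Complex_Analysis"
    "HOL-Real_Asymp.Real_Asymp"
begin

text \<open>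
  The claim reduces to \<open>v < 0 < y\<close>. Put \<open>z = x + 2 u\<^sup>2 - 2 u'\<close>. At imaginary spectral parameter the
  Painleve II Lax pair is the real system
  \<open>S\<^sub>w = (y - 4 w\<^sup>2) D - 4 w u S\<close>, \<open>D\<^sub>w = (z - 4 w\<^sup>2) S + 4 w u D\<close>,
  \<open>S\<^sub>x = w D + u S\<close>, \<open>D\<^sub>x = w S - u D\<close>.
  It is flat, and \<open>S D\<close> at \<open>w = 0\<close> does not depend on \<open>x\<close>. For the solution that is recessive as
  \<open>w \<rightarrow> \<infinity>\<close> this constant is a Stokes datum, which vanishes because the amplitude of \<open>u \<sim> - Ai\<close> is
  exactly one: as \<open>x \<rightarrow> \<infinity>\<close>, Laplace's method and the asymptotics of \<open>Ai\<close> give \<open>S / D \<rightarrow> 0\<close> at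
  \<open>w = 0\<close>. On the other hand \<open>(S D)\<^sub>w = (y - 4 w\<^sup>2) D\<^sup>2 + (z - 4 w\<^sup>2) S\<^sup>2\<close>, so \<open>y \<le> 0\<close> and \<open>z \<le> 0\<close>
  at the same \<open>x\<close> would make \<open>S D\<close> decrease strictly to zero along the recessive solution, hence
  positive at \<open>w = 0\<close>. So \<open>y\<close> and \<open>z\<close> are never both nonpositive. At the largest zero of \<open>u'\<close> one would have
  \<open>y = z = x + 2 u\<^sup>2 \<le> 0\<close> because \<open>u'' \<ge> 0\<close> and \<open>u < 0\<close> there; so \<open>u' > 0\<close> everywhere, \<open>z < y\<close>, and
  therefore \<open>y > 0\<close>.
\<close>

section \<open>The Lax pair\<close>

text \<open>The recessive section is built only where both coefficients are nonpositive, that is,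
  under the hypothesis to be refuted: there the monotonicity of S D and the compactness of the unit
  circle of initial values yield it without asymptotic theory in w. Its smallness as w grows must
  then be carried to large x. For this, sections are defined for all x at once, as power series in w
  whose coefficients solve the x-equation exactly; moving in x costs a factor of order exp(C w),
  while the decay in w beats every exponential. At w = 0 the section is (k 1 exp(U), k (-1) exp(-U))
  with U' = u, so S / D is a positive constant times exp(2 U), and U stays bounded below as x grows;
  this contradicts S / D -> 0. The other obstacle is that only u ~ -Ai is known: negativity,
  monotonicity and the behaviour of u' must be extracted from the differential equation, and u'
  enters the Stokes datum at the same order as u. In the estimates for large x, the substitution x =
  b^4 turns sqrt x, x^(1/4) and x^(3/2) into powers of b.\<close>

locale painleve_solution =
  fixes u :: "real \<Rightarrow> real"
  assumes painleve: "painleve_II u"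
begin

lemma DERIV_u: "(u has_real_derivative deriv u x) (at x)"
  using painleve by (simp add: painleve_II_def field_differentiable_derivI)

lemma DERIV_du: "(deriv u has_real_derivative 2 * u x ^ 3 + x * u x) (at x)"
  using painleve by (simp add: painleve_II_def)

lemma cont_u: "continuous_on A u"
  using DERIV_u DERIV_isCont continuous_at_imp_continuous_on by blast

lemma cont_du: "continuous_on A (deriv u)"
  using DERIV_du DERIV_isCont continuous_at_imp_continuous_on by blast

end

text \<open>Once n exceeds \<open>6 * K\<close>, each term is at most a sixth of the sum of its
  three predecessors. The ratio r = 3/4 satisfies (r^2 + r + 1) / 6 <= r^3, so the terms decay
  geometrically.\<close>

lemma three_term_summable:
  fixes t :: "nat \<Rightarrow> real"
  assumes nonneg: "\<And>n. 0 \<le> t n"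
    and rec: "\<And>n. real (n + 3) * t (n + 3) \<le> K * (t (n + 2) + t (n + 1) + t n)"
  shows "summable t"
proof -
  obtain N :: nat where N: "6 * K \<le> real N"
    using real_arch_simple by blast
  define C where "C = (t N + t (N + 1) + t (N + 2)) / (3/4) ^ 2"
  have step: "t (n + 3) \<le> (t (n + 2) + t (n + 1) + t n) / 6" if "N \<le> n" for n
  proof -
    have "6 * K \<le> real (n + 3)"
      using N that by linarith
    then have "6 * K * (t (n + 2) + t (n + 1) + t n) \<le> real (n + 3) * (t (n + 2) + t (n + 1) + t n)"
      by (intro mult_right_mono) (simp_all add: nonneg)
    with rec[of n] have "real (n + 3) * (6 * t (n + 3)) \<le> real (n + 3) * (t (n + 2) + t (n + 1) + t n)"
      by linarith
    then show ?thesis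
      by (simp only: mult_le_cancel_left) (simp add: field_simps)
  qed
  have C: "0 \<le> C" "t N \<le> C * (3/4) ^ 2" "t (N + 1) \<le> C * (3/4) ^ 2" "t (N + 2) \<le> C * (3/4) ^ 2"
    using nonneg[of N] nonneg[of "N + 1"] nonneg[of "N + 2"] by (simp_all add: C_def)
  have "t (N + n) \<le> C * (3/4) ^ n" for n
  proof (induction n rule: less_induct)
    case (less n)
    have "n = 0 \<or> n = 1 \<or> n = 2 \<or> (\<exists>m. n = m + 3)"
      by presburger
    then consider "n = 0" | "n = 1" | "n = 2" | m where "n = m + 3"
      by blast
    then show ?case
    proof cases
      case 4
      have "t (N + n) \<le> (t (N + (m + 2)) + t (N + (m + 1)) + t (N + m)) / 6"
        using step[of "N + m"] 4 by (simp add: add.assoc)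
      also have "\<dots> \<le> (C * (3/4) ^ (m + 2) + C * (3/4) ^ (m + 1) + C * (3/4) ^ m) / 6"
        using less[of m] less[of "m + 1"] less[of "m + 2"] 4 by simp
      also have "\<dots> = C * (3/4) ^ m * (37 / 96)"
        by (simp add: power_add field_simps power2_eq_square)
      also have "\<dots> \<le> C * (3/4) ^ m * (27 / 64)"
        using C(1) by (intro mult_left_mono) simp_all
      also have "\<dots> = C * (3/4) ^ n"
        by (simp add: 4 power_add power3_eq_cube)
      finally show ?thesis .
    qed (use C in \<open>auto simp: power2_eq_square\<close>)
  qed
  then have bound: "norm (t (n + N)) \<le> C * (3/4) ^ n" for n
    by (simp add: nonneg add.commute[of n])
  have "summable (\<lambda>n. C * (3/4) ^ n)"
    by (intro summable_mult summable_geometric) simp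
  then have "summable (\<lambda>n. t (n + N))"
    by (rule summable_comparison_test'[where N = 0]) (use bound in blast)
  then show ?thesis
    using summable_iff_shift by blast
qed

text \<open>\<open>U\<close> is any primitive: exp(U) and exp(-U) solve the two x-equations at w =
  0, and an additive constant in \<open>U\<close> only rescales the initial values of a
  section.\<close>

locale painleve_lax = painleve_solution u for u :: "real \<Rightarrow> real" +
  fixes U :: "real \<Rightarrow> real"
  assumes antiderivative: "\<And>x. (U has_real_derivative u x) (at x)"
begin

text \<open>\<open>Y 1\<close> and \<open>Y (- 1)\<close> are y and z of the overview; carrying the
  sign \<open>e\<close> lets one proof serve both components.\<close>

definition Y :: "real \<Rightarrow> real \<Rightarrow> real" where
  "Y e x = x + 2 * (u x)\<^sup>2 + 2 * e * deriv u x"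

lemma cont_U: "continuous_on A U"
  using antiderivative DERIV_isCont continuous_at_imp_continuous_on by blast

text \<open>The Painleve II equation enters the compatibility of the two Lax equations only here: it
  closes the derivative of \<open>Y e\<close> into a first-order linear equation for
  \<open>Y e\<close> itself.\<close>

lemma DERIV_Y:
  assumes "e * e = 1"
  shows "(Y e has_real_derivative 1 + 2 * e * u x * Y e x) (at x)"
proof -
  have "(Y e has_real_derivative 1 + 2 * (2 * u x * deriv u x) + 2 * e * (2 * u x ^ 3 + x * u x)) (at x)"
    unfolding Y_def by (auto intro!: derivative_eq_intros DERIV_u DERIV_du)
  also have "1 + 2 * (2 * u x * deriv u x) + 2 * e * (2 * u x ^ 3 + x * u x)
      = 1 + 2 * e * u x * (x + 2 * (u x)\<^sup>2) + 4 * (e * e) * u x * deriv u x"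
    using assms by (simp add: algebra_simps power2_eq_square power3_eq_cube)
  also have "\<dots> = 1 + 2 * e * u x * Y e x"
    by (simp add: Y_def algebra_simps)
  finally show ?thesis .
qed

lemma cont_Y: "continuous_on A (Y e)"
  unfolding Y_def by (intro continuous_intros cont_u cont_du)

text \<open>
  Taylor coefficients in \<open>w\<close> of the section with initial values \<open>k\<close>; \<open>e = 1\<close> selects the component
  \<open>S\<close> and \<open>e = - 1\<close> the component \<open>D\<close>. The recursion is the \<open>w\<close>-equation of the Lax pair.
\<close>

fun lax_coeff :: "(real \<Rightarrow> real) \<Rightarrow> real \<Rightarrow> nat \<Rightarrow> real \<Rightarrow> real" where
  "lax_coeff k e 0 x = k e * exp (e * U x)"
| "lax_coeff k e (Suc 0) x = Y e x * lax_coeff k (- e) 0 x"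
| "lax_coeff k e (Suc (Suc 0)) x =
     (Y e x * lax_coeff k (- e) (Suc 0) x - 4 * e * u x * lax_coeff k e 0 x) / 2"
| "lax_coeff k e (Suc (Suc (Suc n))) x =
     (Y e x * lax_coeff k (- e) (Suc (Suc n)) x - 4 * e * u x * lax_coeff k e (Suc n) x
       - 4 * lax_coeff k (- e) n x) / real (n + 3)"

declare lax_coeff.simps [simp del]

text \<open>Algebra of the inductive step in \<open>DERIV_lax_coeff\<close>: \<open>A\<close> and
  \<open>B\<close> are \<open>Y e\<close> and \<open>Y (- e)\<close>, \<open>d\<close> is u',
  \<open>v\<close> is u, and \<open>c\<close>, \<open>c1\<close>, \<open>c0\<close>,
  \<open>cm\<close> are the coefficients of index n + 2, n + 1, n, n - 1, with signs alternating
  from - e.\<close>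

lemma lax_coeff_identity:
  fixes e A B c c0 c1 cm d v N :: real
  assumes "A = B + 4 * e * d" "N * c = B * c1 + 4 * e * v * c0 - 4 * cm - 2 * c"
  shows "(1 + 2 * e * v * A) * c + (c1 - e * v * c) * A
      - (4 * e * d * c1 + (c0 + e * v * c1) * (4 * e * v)) - 4 * (cm - e * v * c0)
    = (N + 3) * c + e * v * (A * c - 4 * e * v * c1 - 4 * c0)"
  unfolding assms(1) using assms(2) by (simp add: algebra_simps)

lemma lax_coeff_identity_2:
  fixes e A B c c0 d v :: real
  assumes "A = B + 4 * e * d" "c = B * c0"
  shows "(1 + 2 * e * v * A) * c + (c0 - e * v * c) * A
      - (4 * e * d * c0 + e * v * c0 * (4 * e * v))
    = 2 * c + e * v * (A * c - 4 * e * v * c0)"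
  unfolding assms(1) using assms(2) by (simp add: algebra_simps)

text \<open>The coefficient of w^n on the right-hand side of the x-equation; multiplication by w
  shifts the index, hence the default 0 at n = 0.\<close>

definition lax_coeff_dx :: "(real \<Rightarrow> real) \<Rightarrow> real \<Rightarrow> nat \<Rightarrow> real \<Rightarrow> real" where
  "lax_coeff_dx k e n x =
     (if n = 0 then 0 else lax_coeff k (- e) (n - 1) x) + e * u x * lax_coeff k e n x"

text \<open>Flatness of the Lax pair, coefficient by coefficient: the recursion encodes the
  w-equation, and the x-equation propagates along it from the initial coefficient exp(e U).\<close>

lemma DERIV_lax_coeff:
  assumes "e * e = 1"
  shows "(lax_coeff k e n has_real_derivative lax_coeff_dx k e n x) (at x)"
  using assms
proof (induction k e n x rule: lax_coeff.induct)
  case (1 k e x)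
  then show ?case
    by (auto intro!: derivative_eq_intros antiderivative simp: lax_coeff_dx_def lax_coeff.simps)
next
  case (2 k e x)
  then have IH: "(lax_coeff k (- e) 0 has_real_derivative lax_coeff_dx k (- e) 0 x) (at x)" by simp
  have "(lax_coeff k e (Suc 0) has_real_derivative
      (1 + 2 * e * u x * Y e x) * lax_coeff k (- e) 0 x
        + lax_coeff_dx k (- e) 0 x * Y e x) (at x)"
    unfolding lax_coeff.simps(2)
    by (rule DERIV_mult[OF DERIV_Y[OF 2(2)] IH])
  then show ?case
    by (rule DERIV_cong) (simp add: lax_coeff_dx_def lax_coeff.simps algebra_simps)
next
  case (3 k e x)
  then have IH: "(lax_coeff k (- e) (Suc 0) has_real_derivative lax_coeff_dx k (- e) (Suc 0) x) (at x)"
    "(lax_coeff k e 0 has_real_derivative lax_coeff_dx k e 0 x) (at x)" by simp_all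
  have "(lax_coeff k e (Suc (Suc 0)) has_real_derivative
      ((1 + 2 * e * u x * Y e x) * lax_coeff k (- e) (Suc 0) x
        + lax_coeff_dx k (- e) (Suc 0) x * Y e x
        - (4 * e * deriv u x * lax_coeff k e 0 x + lax_coeff_dx k e 0 x * (4 * e * u x))) / 2) (at x)"
    unfolding lax_coeff.simps(3)
    by (intro DERIV_cdivide DERIV_diff DERIV_mult IH DERIV_Y 3 DERIV_cmult DERIV_u)
  moreover have Yc: "Y e x = Y (- e) x + 4 * e * deriv u x"
    by (simp add: Y_def)
  have "(1 + 2 * e * u x * Y e x) * lax_coeff k (- e) (Suc 0) x
        + lax_coeff_dx k (- e) (Suc 0) x * Y e x
        - (4 * e * deriv u x * lax_coeff k e 0 x + lax_coeff_dx k e 0 x * (4 * e * u x))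
      = 2 * lax_coeff_dx k e (Suc (Suc 0)) x"
    using lax_coeff_identity_2[OF Yc, of "lax_coeff k (- e) (Suc 0) x" "lax_coeff k e 0 x" "u x"]
    by (simp add: lax_coeff_dx_def lax_coeff.simps)
  ultimately show ?case
    by (elim DERIV_cong) simp
next
  case (4 k e n x)
  then have IH: "(lax_coeff k (- e) (Suc (Suc n)) has_real_derivative lax_coeff_dx k (- e) (Suc (Suc n)) x) (at x)"
    "(lax_coeff k e (Suc n) has_real_derivative lax_coeff_dx k e (Suc n) x) (at x)"
    "(lax_coeff k (- e) n has_real_derivative lax_coeff_dx k (- e) n x) (at x)" by simp_all
  define c where "c = lax_coeff k"
  have D: "(lax_coeff k e (Suc (Suc (Suc n))) has_real_derivative
      ((1 + 2 * e * u x * Y e x) * c (- e) (Suc (Suc n)) x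
        + lax_coeff_dx k (- e) (Suc (Suc n)) x * Y e x
        - (4 * e * deriv u x * c e (Suc n) x + lax_coeff_dx k e (Suc n) x * (4 * e * u x))
        - 4 * lax_coeff_dx k (- e) n x) / real (n + 3)) (at x)"
    unfolding lax_coeff.simps(4) c_def
    by (intro DERIV_cdivide DERIV_diff DERIV_mult IH DERIV_Y 4 DERIV_cmult DERIV_u)
  have Yc: "Y e x = Y (- e) x + 4 * e * deriv u x"
    by (simp add: Y_def)
  have rec: "(if n = 0 then c (- e) 2 x * 2 = Y (- e) x * c e 1 x + 4 * e * u x * c (- e) 0 x
      else c (- e) (n + 2) x * real (n + 2) = Y (- e) x * c e (n + 1) x + 4 * e * u x * c (- e) n x
        - 4 * c e (n - 1) x)"
    by (cases n) (simp_all add: c_def lax_coeff.simps numeral_2_eq_2 field_simps)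
  have r3: "real (n + 3) * c e (n + 3) x = Y e x * c (- e) (n + 2) x - 4 * e * u x * c e (n + 1) x
       - 4 * c (- e) n x"
    by (simp add: c_def lax_coeff.simps numeral_2_eq_2 numeral_3_eq_3 del: of_nat_Suc)
  \<comment> \<open>The recursion for index 2 has no third term; the default 0 lets n = 0 share the
    general identity.\<close>
  define cm where "cm = (if n = 0 then 0 else c e (n - 1) x)"
  have dx: "lax_coeff_dx k (- e) n x = cm - e * u x * c (- e) n x"
    "lax_coeff_dx k (- e) (n + 2) x = c e (n + 1) x - e * u x * c (- e) (n + 2) x"
    "lax_coeff_dx k e (n + 1) x = c (- e) n x + e * u x * c e (n + 1) x"
    by (simp_all add: lax_coeff_dx_def c_def cm_def)
  have "(1 + 2 * e * u x * Y e x) * c (- e) (n + 2) x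
        + lax_coeff_dx k (- e) (n + 2) x * Y e x
        - (4 * e * deriv u x * c e (n + 1) x + lax_coeff_dx k e (n + 1) x * (4 * e * u x))
        - 4 * lax_coeff_dx k (- e) n x
     = real (n + 3) * c (- e) (n + 2) x + e * u x * (real (n + 3) * c e (n + 3) x)"
  proof -
    have "real n * c (- e) (n + 2) x = Y (- e) x * c e (n + 1) x + 4 * e * u x * c (- e) n x
        - 4 * cm - 2 * c (- e) (n + 2) x"
      using rec by (cases "n = 0") (simp_all add: cm_def algebra_simps numeral_2_eq_2)
    from lax_coeff_identity[OF Yc this] show ?thesis
      unfolding r3 dx by simp
  qed
  then show ?case
    by (intro DERIV_cong[OF D]) (simp add: lax_coeff_dx_def c_def numeral_2_eq_2 numeral_3_eq_3 field_simps)
qed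

end

section \<open>Convergence of the Taylor series in w and termwise differentiation\<close>

lemma sums_shift_Suc:
  fixes f :: "nat \<Rightarrow> real"
  assumes "f sums s"
  shows "(\<lambda>n. if n = 0 then 0 else f (n - 1)) sums s"
  using assms sums_Suc_iff[of "\<lambda>n. if n = 0 then 0 else f (n - 1)" s] by simp

text \<open>\<open>K\<close> bounds Y, 4 u, 4 and the initial values in the recursion of
  \<open>lax_coeff\<close>. The majorant does not depend on x, so it controls the coefficients
  uniformly on compact x-intervals.\<close>

fun lax_majorant :: "real \<Rightarrow> nat \<Rightarrow> real" where
  "lax_majorant K 0 = K"
| "lax_majorant K (Suc 0) = K * lax_majorant K 0"
| "lax_majorant K (Suc (Suc 0)) = K * (lax_majorant K (Suc 0) + lax_majorant K 0)"
| "lax_majorant K (Suc (Suc (Suc n))) =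
     K * (lax_majorant K (Suc (Suc n)) + lax_majorant K (Suc n) + lax_majorant K n) / real (n + 3)"

lemma lax_majorant_nonneg: "0 \<le> K \<Longrightarrow> 0 \<le> lax_majorant K n"
  by (induction K n rule: lax_majorant.induct) simp_all

lemma summable_lax_majorant:
  assumes "0 \<le> K" "0 \<le> r"
  shows "summable (\<lambda>n. lax_majorant K n * r ^ n)"
proof (rule three_term_summable)
  fix n
  \<comment> \<open>The powers r, r^2, r^3 produced by the index shifts are absorbed into one
    constant.\<close>
  let ?t = "\<lambda>n. lax_majorant K n * r ^ n" and ?r = "r + r ^ 2 + r ^ 3"
  have nn: "0 \<le> ?t n" for n
    using assms by (simp add: lax_majorant_nonneg)
  then show "0 \<le> ?t n" .
  have "real (n + 3) * ?t (n + 3) = K * (r * ?t (n + 2) + r ^ 2 * ?t (n + 1) + r ^ 3 * ?t n)"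
    by (simp add: numeral_2_eq_2 numeral_3_eq_3 algebra_simps del: of_nat_Suc of_nat_add)
      (simp add: field_simps)
  also have "\<dots> \<le> K * (?r * ?t (n + 2) + ?r * ?t (n + 1) + ?r * ?t n)"
    by (intro mult_left_mono add_mono mult_right_mono nn) (use assms in auto)
  finally show "real (n + 3) * ?t (n + 3) \<le> (K * ?r) * (?t (n + 2) + ?t (n + 1) + ?t n)"
    by (simp add: algebra_simps)
qed

context painleve_lax
begin

lemma lax_coeff_bound:
  assumes K: "\<bar>Y 1 x\<bar> \<le> K" "\<bar>Y (- 1) x\<bar> \<le> K" "4 * \<bar>u x\<bar> \<le> K" "4 \<le> K"
      "\<bar>k 1 * exp (U x)\<bar> \<le> K" "\<bar>k (- 1) * exp (- U x)\<bar> \<le> K"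
    and e: "e = 1 \<or> e = - 1"
  shows "\<bar>lax_coeff k e n x\<bar> \<le> lax_majorant K n"
proof -
  have K0: "0 \<le> K" using K(4) by simp
  have Ye: "\<bar>Y e x\<bar> \<le> K" if "e = 1 \<or> e = - 1" for e
    using that K by auto
  have ue: "\<bar>4 * e * u x\<bar> \<le> K" if "e = 1 \<or> e = - 1" for e
    using that K(3) by auto
  have YM: "\<bar>Y e x * t\<bar> \<le> K * T" if "e = 1 \<or> e = - 1" "\<bar>t\<bar> \<le> T" for e t T
    unfolding abs_mult by (intro mult_mono Ye that K0) simp
  have uM: "\<bar>4 * e * u x * t\<bar> \<le> K * T" if "e = 1 \<or> e = - 1" "\<bar>t\<bar> \<le> T" for e t T
    unfolding abs_mult[of "4 * e * u x"] by (intro mult_mono ue that K0) simp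
  have cM: "\<bar>4 * t\<bar> \<le> K * T" if "\<bar>t\<bar> \<le> T" for t T
    unfolding abs_mult by (intro mult_mono that K0) (use K(4) in auto)
  show ?thesis
    using e
  proof (induction n arbitrary: e rule: less_induct)
    case (less n)
    have e': "- e = 1 \<or> - e = - 1" using less.prems by auto
    have "n = 0 \<or> n = 1 \<or> n = 2 \<or> (\<exists>m. n = Suc (Suc (Suc m)))"
      by presburger
    then consider "n = 0" | "n = 1" | "n = 2" | m where "n = Suc (Suc (Suc m))"
      by blast
    then show ?case
    proof cases
      case 1
      then show ?thesis
        using K less.prems by (auto simp: lax_coeff.simps)
    next
      case 2
      then show ?thesis
        using YM[OF less.prems less.IH[OF _ e', of 0]] by (simp add: lax_coeff.simps)
    next
      case 3
      have "\<bar>Y e x * lax_coeff k (- e) (Suc 0) x\<bar> \<le> K * lax_majorant K (Suc 0)"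
        by (rule YM[OF less.prems less.IH[OF _ e']]) (simp add: 3)
      moreover have "\<bar>4 * e * u x * lax_coeff k e 0 x\<bar> \<le> K * lax_majorant K 0"
        by (rule uM[OF less.prems less.IH[OF _ less.prems]]) (simp add: 3)
      moreover have "lax_coeff k e n x * 2 = Y e x * lax_coeff k (- e) (Suc 0) x - 4 * e * u x * lax_coeff k e 0 x"
        by (simp add: 3 numeral_2_eq_2 lax_coeff.simps)
      moreover have "lax_majorant K n = K * lax_majorant K (Suc 0) + K * lax_majorant K 0"
        by (simp add: 3 numeral_2_eq_2 algebra_simps)
      ultimately show ?thesis
        by linarith
    next
      case 4
      have "\<bar>Y e x * lax_coeff k (- e) (Suc (Suc m)) x\<bar> \<le> K * lax_majorant K (Suc (Suc m))"
        by (rule YM[OF less.prems less.IH[OF _ e']]) (simp add: 4)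
      moreover have "\<bar>4 * e * u x * lax_coeff k e (Suc m) x\<bar> \<le> K * lax_majorant K (Suc m)"
        by (rule uM[OF less.prems less.IH[OF _ less.prems]]) (simp add: 4)
      moreover have "\<bar>4 * lax_coeff k (- e) m x\<bar> \<le> K * lax_majorant K m"
        by (rule cM[OF less.IH[OF _ e']]) (simp add: 4)
      ultimately have "\<bar>Y e x * lax_coeff k (- e) (Suc (Suc m)) x - 4 * e * u x * lax_coeff k e (Suc m) x
          - 4 * lax_coeff k (- e) m x\<bar>
        \<le> K * (lax_majorant K (Suc (Suc m)) + lax_majorant K (Suc m) + lax_majorant K m)"
        unfolding distrib_left by linarith
      then show ?thesis
        unfolding 4 lax_coeff.simps(4) lax_majorant.simps(4) abs_divide
        by (intro divide_mono) auto
    qed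
  qed
qed

definition lax :: "(real \<Rightarrow> real) \<Rightarrow> real \<Rightarrow> real \<Rightarrow> real \<Rightarrow> real" where
  "lax k e w x = (\<Sum>n. lax_coeff k e n x * w ^ n)"

lemma lax_0: "lax k e 0 x = k e * exp (e * U x)"
proof -
  have "lax k e 0 x = (\<Sum>n. lax_coeff k e n x * 0 ^ n)"
    by (simp add: lax_def)
  also have "\<dots> = lax_coeff k e 0 x"
    by (rule powser_zero)
  finally show ?thesis
    by (simp add: lax_coeff.simps)
qed

lemma lax_coeff_bound_compact:
  obtains K where "0 \<le> K"
    "\<And>x e n. \<lbrakk>x \<in> {a..b}; e = 1 \<or> e = - 1\<rbrakk> \<Longrightarrow> \<bar>lax_coeff k e n x\<bar> \<le> lax_majorant K n"
    "\<And>x. x \<in> {a..b} \<Longrightarrow> \<bar>u x\<bar> \<le> K"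
proof -
  have bdd: "\<exists>M. \<forall>x\<in>{a..b}. \<bar>f x\<bar> \<le> M" if "continuous_on {a..b} f" for f :: "real \<Rightarrow> real"
    using compact_continuous_image[OF that] compact_imp_bounded
    by (force simp: bounded_iff)
  obtain M1 where M1: "\<forall>x\<in>{a..b}. \<bar>Y 1 x\<bar> \<le> M1" using bdd[OF cont_Y] by blast
  obtain M2 where M2: "\<forall>x\<in>{a..b}. \<bar>Y (- 1) x\<bar> \<le> M2" using bdd[OF cont_Y] by blast
  obtain M3 where M3: "\<forall>x\<in>{a..b}. \<bar>4 * u x\<bar> \<le> M3"
    using bdd[OF continuous_on_mult_left[OF cont_u]] by blast
  obtain M4 where M4: "\<forall>x\<in>{a..b}. \<bar>k 1 * exp (U x)\<bar> \<le> M4"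
    using bdd[OF continuous_on_mult_left[OF continuous_on_exp[OF cont_U]]] by blast
  obtain M5 where M5: "\<forall>x\<in>{a..b}. \<bar>k (- 1) * exp (- U x)\<bar> \<le> M5"
    using bdd[OF continuous_on_mult_left[OF continuous_on_exp[OF continuous_on_minus[OF cont_U]]]] by blast
  define K where "K = Max {M1, M2, M3, M4, M5, 4}"
  have K: "M1 \<le> K" "M2 \<le> K" "M3 \<le> K" "M4 \<le> K" "M5 \<le> K" "4 \<le> K"
    by (simp_all add: K_def)
  show ?thesis
  proof
    show "0 \<le> K" using K by simp
    fix x assume x: "x \<in> {a..b}"
    have b: "\<bar>Y 1 x\<bar> \<le> K" "\<bar>Y (- 1) x\<bar> \<le> K" "\<bar>4 * u x\<bar> \<le> K"
      "\<bar>k 1 * exp (U x)\<bar> \<le> K" "\<bar>k (- 1) * exp (- U x)\<bar> \<le> K"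
      using M1 M2 M3 M4 M5 x K by (meson order_trans)+
    then show "\<bar>u x\<bar> \<le> K" by linarith
    show "\<bar>lax_coeff k e n x\<bar> \<le> lax_majorant K n" if "e = 1 \<or> e = - 1" for e n
      using b(3) by (intro lax_coeff_bound[OF b(1,2) _ K(6) b(4,5) that]) (simp add: abs_mult)
  qed
qed

lemma summable_lax:
  assumes e: "e = 1 \<or> e = - 1"
  shows "summable (\<lambda>n. lax_coeff k e n x * w ^ n)"
proof -
  obtain K where K: "0 \<le> K"
    "\<And>x' e n. \<lbrakk>x' \<in> {x..x}; e = 1 \<or> e = - 1\<rbrakk> \<Longrightarrow> \<bar>lax_coeff k e n x'\<bar> \<le> lax_majorant K n"
    using lax_coeff_bound_compact[of x x k] by metis
  have "norm (lax_coeff k e n x * w ^ n) \<le> lax_majorant K n * \<bar>w\<bar> ^ n" for n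
    using K(2)[of x e n] e by (simp add: abs_mult power_abs mult_right_mono)
  then show ?thesis
    by (intro summable_comparison_test'[where N = 0, OF summable_lax_majorant[of K "\<bar>w\<bar>"]])
      (use K in auto)
qed

lemma DERIV_lax_w:
  assumes e: "e = 1 \<or> e = - 1"
  shows "((\<lambda>w. lax k e w x) has_real_derivative
    (Y e x - 4 * w\<^sup>2) * lax k (- e) w x - 4 * e * w * u x * lax k e w x) (at w)"
proof -
  have e': "- e = 1 \<or> - e = - 1" using e by auto
  let ?a = "\<lambda>n. lax_coeff k e n x" and ?b = "\<lambda>n. lax_coeff k (- e) n x"
  let ?f = "\<lambda>n. Y e x * (?b n * w ^ n)"
  \<comment> \<open>The factors w and w^2 are absorbed by shifting the index by one and two, with
    zeros in the vacated places, so that all three series carry w^n.\<close>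
  let ?g = "\<lambda>n. if n = 0 then 0 else 4 * e * w * u x * (?a (n - 1) * w ^ (n - 1))"
  let ?h = "\<lambda>n. if n < 2 then 0 else 4 * w\<^sup>2 * (?b (n - 2) * w ^ (n - 2))"
  have f: "?f sums (Y e x * lax k (- e) w x)"
    unfolding lax_def by (intro sums_mult summable_sums summable_lax e')
  have g: "?g sums (4 * e * w * u x * lax k e w x)"
    unfolding lax_def by (intro sums_shift_Suc sums_mult summable_sums summable_lax e)
  have h: "?h sums (4 * w\<^sup>2 * lax k (- e) w x)"
  proof -
    have "(\<lambda>n. ?h (n + 2)) sums (4 * w\<^sup>2 * lax k (- e) w x)"
      by (simp add: lax_def, intro sums_mult summable_sums summable_lax e')
    then show ?thesis
      by (subst (asm) sums_iff_shift) (simp add: numeral_2_eq_2)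
  qed
  have "diffs ?a n * w ^ n = ?f n - ?g n - ?h n" for n
  proof -
    have "n = 0 \<or> n = 1 \<or> (\<exists>m. n = Suc (Suc m))"
      by presburger
    then consider "n = 0" | "n = 1" | m where "n = Suc (Suc m)"
      by blast
    then show ?thesis
    proof cases
      case 3
      have "real (m + 3) * ?a (Suc (Suc (Suc m))) = Y e x * ?b (Suc (Suc m)) - 4 * e * u x * ?a (Suc m) - 4 * ?b m"
        by (simp add: lax_coeff.simps)
      then have "diffs ?a n = Y e x * ?b (Suc (Suc m)) - 4 * e * u x * ?a (Suc m) - 4 * ?b m"
        by (simp add: diffs_def 3 algebra_simps)
      then show ?thesis
        by (simp only:) (simp add: 3 algebra_simps power2_eq_square)
    qed (simp_all add: diffs_def lax_coeff.simps algebra_simps)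
  qed
  then have sums: "(\<lambda>n. diffs ?a n * w ^ n) sums
      (Y e x * lax k (- e) w x - 4 * e * w * u x * lax k e w x - 4 * w\<^sup>2 * lax k (- e) w x)"
    using sums_diff[OF sums_diff[OF f g] h] by simp
  have "((\<lambda>w. lax k e w x) has_real_derivative (\<Sum>n. diffs ?a n * w ^ n)) (at w)"
    unfolding lax_def
    by (rule termdiffs_strong_converges_everywhere) (rule summable_lax[OF e])
  then show ?thesis
    unfolding sums_unique[OF sums, symmetric] by (rule DERIV_cong) (simp add: algebra_simps)
qed

text \<open>Differentiation in x is not that of a power series; it rests on uniform convergence of
  the differentiated series on [x - 1, x + 1], by the Weierstrass test with the majorant.\<close>

lemma DERIV_lax_x:
  assumes e: "e = 1 \<or> e = - 1"
  shows "((\<lambda>x. lax k e w x) has_real_derivative w * lax k (- e) w x + e * u x * lax k e w x) (at x)"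
proof -
  have e': "- e = 1 \<or> - e = - 1" and ee: "e * e = 1" using e by auto
  let ?S = "{x - 1..x + 1}"
  obtain K where K: "0 \<le> K"
    "\<And>x' e n. \<lbrakk>x' \<in> ?S; e = 1 \<or> e = - 1\<rbrakk> \<Longrightarrow> \<bar>lax_coeff k e n x'\<bar> \<le> lax_majorant K n"
    "\<And>x'. x' \<in> ?S \<Longrightarrow> \<bar>u x'\<bar> \<le> K"
    using lax_coeff_bound_compact[of "x - 1" "x + 1" k] by metis
  define M where "M n = (if n = 0 then 0 else \<bar>w\<bar> * (lax_majorant K (n - 1) * \<bar>w\<bar> ^ (n - 1)))
      + K * (lax_majorant K n * \<bar>w\<bar> ^ n)" for n
  have sM: "summable M"
    unfolding M_def
  proof (intro summable_add summable_mult summable_lax_majorant)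
    have "summable (\<lambda>n. \<bar>w\<bar> * (lax_majorant K n * \<bar>w\<bar> ^ n))"
      using K by (intro summable_mult summable_lax_majorant) auto
    then show "summable (\<lambda>n. if n = 0 then 0 else \<bar>w\<bar> * (lax_majorant K (n - 1) * \<bar>w\<bar> ^ (n - 1)))"
      by (subst summable_Suc_iff[symmetric]) simp
  qed (use K in auto)
  have bd: "norm (lax_coeff_dx k e n x' * w ^ n) \<le> M n" if x': "x' \<in> ?S" for n x'
  proof -
    have "\<bar>e * u x' * lax_coeff k e n x' * w ^ n\<bar> \<le> K * (lax_majorant K n * \<bar>w\<bar> ^ n)"
    proof -
      have "\<bar>e * u x' * lax_coeff k e n x' * w ^ n\<bar> = \<bar>u x'\<bar> * (\<bar>lax_coeff k e n x'\<bar> * \<bar>w\<bar> ^ n)"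
        using e by (auto simp: abs_mult power_abs)
      also have "\<dots> \<le> K * (lax_majorant K n * \<bar>w\<bar> ^ n)"
        by (intro mult_mono K x' e mult_nonneg_nonneg) (use K in \<open>auto simp: lax_majorant_nonneg\<close>)
      finally show ?thesis .
    qed
    moreover have "\<bar>lax_coeff k (- e) (n - 1) x' * w ^ n\<bar> \<le> \<bar>w\<bar> * (lax_majorant K (n - 1) * \<bar>w\<bar> ^ (n - 1))"
      if "n \<noteq> 0"
    proof -
      have "\<bar>lax_coeff k (- e) (n - 1) x' * w ^ n\<bar> = \<bar>w\<bar> * (\<bar>lax_coeff k (- e) (n - 1) x'\<bar> * \<bar>w\<bar> ^ (n - 1))"
        using that by (cases n) (auto simp: abs_mult power_abs)
      also have "\<dots> \<le> \<bar>w\<bar> * (lax_majorant K (n - 1) * \<bar>w\<bar> ^ (n - 1))"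
        by (intro mult_left_mono mult_right_mono K x' e') auto
      finally show ?thesis .
    qed
    ultimately show ?thesis
      by (cases "n = 0") (auto simp: lax_coeff_dx_def M_def distrib_right intro: order_trans[OF abs_triangle_ineq])
  qed
  have *: "((\<lambda>x. \<Sum>n. lax_coeff k e n x * w ^ n) has_real_derivative (\<Sum>n. lax_coeff_dx k e n x * w ^ n)) (at x)"
  proof (rule has_field_derivative_series'(2))
    show "convex ?S" by simp
    show "((\<lambda>x. lax_coeff k e n x * w ^ n) has_real_derivative lax_coeff_dx k e n x' * w ^ n) (at x' within ?S)" for n x'
      using DERIV_cmult_right[OF DERIV_lax_coeff[OF ee]] has_field_derivative_at_within by blast
    show "uniformly_convergent_on ?S (\<lambda>n x. \<Sum>i<n. lax_coeff_dx k e i x * w ^ i)"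
      by (rule Weierstrass_m_test'[OF bd sM])
    show "x \<in> ?S" "x \<in> interior ?S" by simp_all
    show "summable (\<lambda>n. lax_coeff k e n x * w ^ n)" by (rule summable_lax[OF e])
  qed
  have "(\<lambda>n. if n = 0 then 0 else w * (lax_coeff k (- e) (n - 1) x * w ^ (n - 1))) sums (w * lax k (- e) w x)"
    unfolding lax_def by (intro sums_shift_Suc sums_mult summable_sums summable_lax e')
  moreover have "(\<lambda>n. e * u x * (lax_coeff k e n x * w ^ n)) sums (e * u x * lax k e w x)"
    unfolding lax_def by (intro sums_mult summable_sums summable_lax e)
  ultimately have "(\<lambda>n. (if n = 0 then 0 else w * (lax_coeff k (- e) (n - 1) x * w ^ (n - 1)))
      + e * u x * (lax_coeff k e n x * w ^ n)) sums (w * lax k (- e) w x + e * u x * lax k e w x)"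
    by (rule sums_add)
  moreover have "(if n = 0 then 0 else w * (lax_coeff k (- e) (n - 1) x * w ^ (n - 1)))
      + e * u x * (lax_coeff k e n x * w ^ n) = lax_coeff_dx k e n x * w ^ n" for n
    by (cases n) (simp_all add: lax_coeff_dx_def algebra_simps)
  ultimately have "(\<lambda>n. lax_coeff_dx k e n x * w ^ n) sums (w * lax k (- e) w x + e * u x * lax k e w x)"
    by simp
  with * show ?thesis
    by (simp add: lax_def sums_iff)
qed

end

lemma has_integral_of_DERIV:
  fixes f F :: "real \<Rightarrow> real"
  assumes "a \<le> b" "\<And>x. (F has_real_derivative f x) (at x)"
  shows "(f has_integral F b - F a) {a..b}"
  using assms
  by (intro fundamental_theorem_of_calculus)
    (auto simp flip: has_real_derivative_iff_has_vector_derivative intro: has_field_derivative_at_within)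

section \<open>The Airy function at infinity\<close>

text \<open>Replaces integrating an estimate of f': both g - f and g + f are nondecreasing.\<close>

lemma abs_diff_le_of_deriv_le:
  fixes f g :: "real \<Rightarrow> real"
  assumes "a \<le> b"
    and f: "\<And>x. \<lbrakk>a \<le> x; x \<le> b\<rbrakk> \<Longrightarrow> (f has_real_derivative f' x) (at x)"
    and g: "\<And>x. \<lbrakk>a \<le> x; x \<le> b\<rbrakk> \<Longrightarrow> (g has_real_derivative g' x) (at x)"
    and le: "\<And>x. \<lbrakk>a \<le> x; x \<le> b\<rbrakk> \<Longrightarrow> \<bar>f' x\<bar> \<le> g' x"
  shows "\<bar>f b - f a\<bar> \<le> g b - g a"
proof -
  have "(\<lambda>x. g x - f x) a \<le> (\<lambda>x. g x - f x) b"
  proof (rule DERIV_nonneg_imp_nondecreasing[OF \<open>a \<le> b\<close>])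
    fix x assume x: "a \<le> x" "x \<le> b"
    show "\<exists>y. ((\<lambda>x. g x - f x) has_real_derivative y) (at x) \<and> 0 \<le> y"
      using le[OF x] by (intro exI[of _ "g' x - f' x"] conjI DERIV_diff f g x) simp
  qed
  moreover have "(\<lambda>x. g x + f x) a \<le> (\<lambda>x. g x + f x) b"
  proof (rule DERIV_nonneg_imp_nondecreasing[OF \<open>a \<le> b\<close>])
    fix x assume x: "a \<le> x" "x \<le> b"
    show "\<exists>y. ((\<lambda>x. g x + f x) has_real_derivative y) (at x) \<and> 0 \<le> y"
      using le[OF x] by (intro exI[of _ "g' x + f' x"] conjI DERIV_add f g x) simp
  qed
  ultimately show ?thesis by simp
qed

text \<open>Covers integrands such as the Airy one that are not absolutely integrable. A box
  containing a large ball contains \<open>a\<close> and ends beyond \<open>B\<close>, so the cut-off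
  function integrates over it to an ordinary integral from \<open>a\<close>, already close to
  \<open>L\<close>.\<close>

lemma has_integral_improper:
  fixes f :: "real \<Rightarrow> real"
  assumes cont: "\<And>x. isCont f x"
    and lim: "((\<lambda>R. integral {a..R} f) \<longlongrightarrow> L) at_top"
  shows "(f has_integral L) {a..}"
  unfolding has_integral_alt'
proof (intro conjI allI impI)
  let ?h = "\<lambda>x. if x \<in> {a..} then f x else 0"
  have cut: "(?h has_integral integral {a..d} f) (cbox c d)" if "c \<le> a" for c d
  proof -
    have "f integrable_on {a..d}"
      by (intro integrable_continuous_real continuous_at_imp_continuous_on) (simp add: cont)
    then have int: "((\<lambda>x. if x \<in> {a..d} then f x else 0) has_integral integral {a..d} f) {c..d}"
      using that by (subst has_integral_restrict) (auto simp: has_integral_iff)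
    show ?thesis
      unfolding cbox_interval by (rule has_integral_eq[OF _ int]) auto
  qed
  show "?h integrable_on cbox c d" for c d :: real
  proof -
    have "?h integrable_on cbox (min c a) d"
      using cut[of "min c a" d] by (auto intro: has_integral_integrable)
    then show ?thesis
      by (rule integrable_on_subcbox) (auto simp: cbox_interval)
  qed
  fix e :: real assume "e > 0"
  with lim have "eventually (\<lambda>R. \<bar>integral {a..R} f - L\<bar> < e) at_top"
    by (auto dest!: tendstoD simp: dist_real_def)
  then obtain B where B: "\<And>R. R \<ge> B \<Longrightarrow> \<bar>integral {a..R} f - L\<bar> < e"
    by (auto simp: eventually_at_top_linorder)
  let ?r = "max B (\<bar>a\<bar> + 1)"
  show "\<exists>B>0. \<forall>c d. ball 0 B \<subseteq> cbox c d \<longrightarrow> norm (integral (cbox c d) ?h - L) < e"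
  proof (intro exI[of _ ?r] conjI allI impI)
    fix c d :: real assume sub: "ball 0 ?r \<subseteq> cbox c d"
    have "a \<in> cbox c d"
      using sub by (rule subsetD) (auto simp: dist_real_def)
    then have a: "c \<le> a" "a \<le> d" by (simp_all add: cbox_interval)
    have "B \<le> d"
    proof (rule ccontr)
      assume "\<not> B \<le> d"
      then have "d < ?r" by simp
      then obtain t where t: "d < t" "t < ?r" using dense by blast
      with a have "\<bar>t\<bar> < ?r" by linarith
      then have "t \<in> ball 0 ?r" by (simp add: dist_real_def)
      then have "t \<in> cbox c d" using sub by blast
      then show False using t by (simp add: cbox_interval)
    qed
    then show "norm (integral (cbox c d) ?h - L) < e"
      using B[of d] integral_unique[OF cut[OF a(1)]] by simp
  qed (simp add: less_max_iff_disj add_nonneg_pos)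
qed

text \<open>What remains of the Airy integral for x = b^4 on the horizontal line through the saddle
  i b^2, after dividing out the saddle value and rescaling by b. As an absolutely convergent
  Lebesgue integral it admits dominated convergence.\<close>

definition airy_gauss :: "real \<Rightarrow> real" where
  "airy_gauss b = (LBINT t:{0..}. exp (- t\<^sup>2) * cos (t ^ 3 / (3 * b ^ 3)))"

lemma gauss_half_line: "set_integrable lborel {0..} (\<lambda>t::real. exp (- t\<^sup>2))"
  "(LBINT t:{0..}. exp (- t\<^sup>2)) = sqrt pi / 2"
  using gaussian_moment_0 by (auto simp: set_integrable_def set_lebesgue_integral_def has_bochner_integral_iff)

lemma airy_gauss_integrable:
  fixes b :: real
  shows "set_integrable lborel {0..} (\<lambda>t. exp (- t\<^sup>2) * cos (t ^ 3 / (3 * b ^ 3)))"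
  using gauss_half_line(1)
  by (rule set_integrable_bound)
    (auto simp: set_borel_measurable_def abs_mult intro!: mult_left_le)

lemma integral_tendsto_airy_gauss:
  "((\<lambda>T. integral {0..T} (\<lambda>t. exp (- t\<^sup>2) * cos (t ^ 3 / (3 * b ^ 3)))) \<longlongrightarrow> airy_gauss b) at_top"
proof -
  let ?f = "\<lambda>t. exp (- t\<^sup>2) * cos (t ^ 3 / (3 * b ^ 3))"
  have "((\<lambda>y. \<integral>x. indicator {..y} x *\<^sub>R (indicator {0..} x *\<^sub>R ?f x) \<partial>lborel) \<longlongrightarrow> airy_gauss b) at_top"
    unfolding airy_gauss_def set_lebesgue_integral_def
    using airy_gauss_integrable[of b] unfolding set_integrable_def
    by (intro tendsto_integral_at_top) auto
  moreover have "(\<integral>x. indicator {..y} x *\<^sub>R (indicator {0..} x *\<^sub>R ?f x) \<partial>lborel) = integral {0..y} ?f" for y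
  proof -
    have "set_integrable lborel {0..y} ?f"
      by (rule set_integrable_subset[OF airy_gauss_integrable]) auto
    from set_borel_integral_eq_integral(2)[OF this] show ?thesis
      unfolding set_lebesgue_integral_def
      by (subst (asm) eq_commute, simp)
        (rule Bochner_Integration.integral_cong; auto split: split_indicator)
  qed
  ultimately show ?thesis by simp
qed

text \<open>The phase z^3 / 3 + b^4 z has a saddle at z = i b^2. Along z = t / b + i b^2 the
  exponent is -2/3 b^6 - t^2 + i t^3 / (3 b^3), so moving the half-line up to that height produces
  the Gaussian.\<close>

lemma Airy_Ai_steepest_descent:
  assumes b: "b > 0"
  shows "Airy_Ai (b ^ 4) = exp (- (2 / 3) * b ^ 6) / (pi * b) * airy_gauss b"
proof -
  define g where "g z = exp (\<i> * (z ^ 3 / 3 + of_real (b ^ 4) * z))" for z :: complex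
  \<comment> \<open>A global primitive stands in for Cauchy's theorem: the integral along each edge
    of the rectangle is a difference of values of \<open>G\<close>.\<close>
  have "g holomorphic_on UNIV"
    unfolding g_def by (intro holomorphic_intros) auto
  then obtain G where G: "\<And>z. (G has_field_derivative g z) (at z)"
    using holomorphic_convex_primitive'[of UNIV g] by auto
  have line: "((\<lambda>t. Re (G (p + of_real t * q))) has_real_derivative Re (q * g (p + of_real t * q))) (at t)"
    for p q t
  proof -
    have "((\<lambda>t. p + of_real t * q) has_vector_derivative q) (at t)"
      by (auto intro!: derivative_eq_intros)
    from field_vector_diff_chain_at[OF this G]
    have "((\<lambda>t. G (p + of_real t * q)) has_vector_derivative q * g (p + of_real t * q)) (at t)"
      by (simp add: o_def)
    then have "((\<lambda>t. Re (G (p + of_real t * q))) has_vector_derivative Re (q * g (p + of_real t * q))) (at t)"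
      by (rule bounded_linear.has_vector_derivative[OF bounded_linear_Re])
    then show ?thesis
      by (simp add: has_real_derivative_iff_has_vector_derivative)
  qed
  let ?f = "\<lambda>t. cos (t ^ 3 / 3 + b ^ 4 * t)"
  have gre: "Re (g (of_real t)) = ?f t" for t
  proof -
    have "\<i> * (of_real t ^ 3 / 3 + of_real (b ^ 4) * of_real t) = \<i> * of_real (t ^ 3 / 3 + b ^ 4 * t)"
      by simp
    then show ?thesis
      unfolding g_def by (simp only: Re_exp) simp
  qed
  have int_f: "integral {0..R} ?f = Re (G (of_real R)) - Re (G 0)" if "R \<ge> 0" for R
  proof -
    have "((\<lambda>t. Re (G (of_real t))) has_real_derivative ?f t) (at t)" for t
      using line[of 0 1 t] by (simp add: gre)
    from integral_unique[OF has_integral_of_DERIV[OF that this]] show ?thesis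
      by simp
  qed
  have re_exponent: "Re (\<i> * ((of_real r + of_real s * \<i>) ^ 3 / 3 + of_real (b ^ 4) * (of_real r + of_real s * \<i>)))
      = - r\<^sup>2 * s + s ^ 3 / 3 - b ^ 4 * s"
    "Im (\<i> * ((of_real r + of_real s * \<i>) ^ 3 / 3 + of_real (b ^ 4) * (of_real r + of_real s * \<i>)))
      = r ^ 3 / 3 - r * s\<^sup>2 + b ^ 4 * r" for r s
    by (simp_all add: power3_eq_cube power2_eq_square field_simps)
  \<comment> \<open>The integrand times \<open>\<i>\<close> is purely imaginary on the imaginary axis, so this segment drops out.\<close>
  have vertical_0: "Re (G (of_real (b\<^sup>2) * \<i>)) = Re (G 0)"
  proof -
    have "Re (\<i> * g (of_real t * \<i>)) = 0" for t
    proof -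
      have "Im (g (of_real t * \<i>)) = 0"
        using re_exponent(2)[of 0 t] by (simp add: g_def Im_exp)
      then show ?thesis by simp
    qed
    then have "\<forall>t. ((\<lambda>t. Re (G (of_real t * \<i>))) has_real_derivative 0) (at t)"
      using line[of 0 \<i>] by simp
    from DERIV_isconst_all[OF this, of "b\<^sup>2" 0] show ?thesis by simp
  qed
  \<comment> \<open>On the right edge s^3 / 3 <= b^4 s for s <= b^2, so the modulus is at most exp(-
    R^2 s), whose integral in s is below 1 / R^2.\<close>
  have vertical_R: "\<bar>Re (G (of_real R + of_real (b\<^sup>2) * \<i>)) - Re (G (of_real R))\<bar> \<le> 1 / R\<^sup>2" if "R > 0" for R
  proof -
    have "\<bar>Re (G (of_real R + of_real (b\<^sup>2) * \<i>)) - Re (G (of_real R + of_real 0 * \<i>))\<bar>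
      \<le> - exp (- R\<^sup>2 * b\<^sup>2) / R\<^sup>2 - - exp (- R\<^sup>2 * 0) / R\<^sup>2"
    proof (rule abs_diff_le_of_deriv_le[where f = "\<lambda>s. Re (G (of_real R + of_real s * \<i>))"])
      fix s assume s: "0 \<le> s" "s \<le> b\<^sup>2"
      show "((\<lambda>s. Re (G (of_real R + of_real s * \<i>))) has_real_derivative Re (\<i> * g (of_real R + of_real s * \<i>))) (at s)"
        by (rule line)
      show "((\<lambda>s. - exp (- R\<^sup>2 * s) / R\<^sup>2) has_real_derivative exp (- R\<^sup>2 * s)) (at s)"
        using that by (auto intro!: derivative_eq_intros) (simp add: power2_eq_square power4_eq_xxxx)
      have "s * s\<^sup>2 \<le> s * (b\<^sup>2)\<^sup>2"
        using s by (intro mult_left_mono power_mono) auto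
      then have "s ^ 3 \<le> b ^ 4 * s"
        by (simp add: power3_eq_cube power2_eq_square power4_eq_xxxx mult.commute)
      moreover have "0 \<le> s ^ 3"
        using s by simp
      ultimately have "s ^ 3 / 3 \<le> b ^ 4 * s"
        by linarith
      then have "cmod (g (of_real R + of_real s * \<i>)) \<le> exp (- R\<^sup>2 * s)"
        unfolding g_def norm_exp_eq_Re re_exponent by simp
      then show "\<bar>Re (\<i> * g (of_real R + of_real s * \<i>))\<bar> \<le> exp (- R\<^sup>2 * s)"
        using abs_Re_le_cmod[of "\<i> * g (of_real R + of_real s * \<i>)"] by (simp add: norm_mult)
    qed simp
    also have "\<dots> \<le> 1 / R\<^sup>2"
      by simp
    finally show ?thesis by simp
  qed
  let ?h = "\<lambda>t. exp (- t\<^sup>2) * cos (t ^ 3 / (3 * b ^ 3))"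
  have horizontal: "Re (G (of_real (b\<^sup>2) * \<i> + of_real T * of_real (1 / b))) - Re (G (of_real (b\<^sup>2) * \<i>))
      = exp (- (2 / 3) * b ^ 6) / b * integral {0..T} ?h" if "T \<ge> 0" for T
  proof -
    have "Re (of_real (1 / b) * g (of_real (b\<^sup>2) * \<i> + of_real t * of_real (1 / b)))
        = exp (- (2 / 3) * b ^ 6) / b * ?h t" for t
    proof -
      have z: "of_real (b\<^sup>2) * \<i> + of_real t * of_real (1 / b) = of_real (t / b) + of_real (b\<^sup>2) * \<i>"
        by simp
      have "(t / b)\<^sup>2 * b\<^sup>2 = t\<^sup>2"
        using b by (simp add: power_divide)
      moreover have "(b\<^sup>2) ^ 3 = b ^ 6" "b ^ 4 * b\<^sup>2 = b ^ 6" "(b\<^sup>2)\<^sup>2 = b ^ 4"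
        by (simp_all flip: power_mult power_add)
      ultimately have "- (t / b)\<^sup>2 * b\<^sup>2 + (b\<^sup>2) ^ 3 / 3 - b ^ 4 * b\<^sup>2 = - (2 / 3) * b ^ 6 + - t\<^sup>2"
        "(t / b) ^ 3 / 3 - t / b * (b\<^sup>2)\<^sup>2 + b ^ 4 * (t / b) = t ^ 3 / (3 * b ^ 3)"
        by (simp_all add: power_divide)
      then
      have "Re (g (of_real (t / b) + of_real (b\<^sup>2) * \<i>)) = exp (- (2 / 3) * b ^ 6 + - t\<^sup>2) * cos (t ^ 3 / (3 * b ^ 3))"
        unfolding g_def Re_exp re_exponent by (simp add: mult.commute)
      moreover have "Re (of_real (1 / b) * g z) = Re (g z) / b" for z
        using Re_divide_of_real[of "g z" b] by simp
      ultimately show ?thesis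
        unfolding z by (simp only: exp_add times_divide_eq_left mult.assoc)
    qed
    with line[of "of_real (b\<^sup>2) * \<i>" "of_real (1 / b)"]
    have "((\<lambda>t. exp (- (2 / 3) * b ^ 6) / b * ?h t) has_integral
       Re (G (of_real (b\<^sup>2) * \<i> + of_real T * of_real (1 / b)))
       - Re (G (of_real (b\<^sup>2) * \<i> + of_real 0 * of_real (1 / b)))) {0..T}"
      by (intro has_integral_of_DERIV[OF that]) metis
    from integral_unique[OF this] show ?thesis by simp
  qed
  let ?L = "exp (- (2 / 3) * b ^ 6) / b * airy_gauss b"
  have "((\<lambda>R. integral {0..R} ?f) \<longlongrightarrow> ?L) at_top"
  proof -
    have "((\<lambda>R. exp (- (2 / 3) * b ^ 6) / b * integral {0..R * b} ?h) \<longlongrightarrow> ?L) at_top"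
      by (intro tendsto_mult tendsto_const filterlim_compose[OF integral_tendsto_airy_gauss]
          filterlim_at_top_mult_tendsto_pos[OF _ b] filterlim_ident)
    moreover have "((\<lambda>R. integral {0..R} ?f - exp (- (2 / 3) * b ^ 6) / b * integral {0..R * b} ?h) \<longlongrightarrow> 0) at_top"
    proof (rule Lim_null_comparison)
      show "((\<lambda>R. 1 / R\<^sup>2) \<longlongrightarrow> (0::real)) at_top" by real_asymp
      show "eventually (\<lambda>R. norm (integral {0..R} ?f - exp (- (2 / 3) * b ^ 6) / b * integral {0..R * b} ?h) \<le> 1 / R\<^sup>2) at_top"
        using eventually_gt_at_top[of 0]
      proof eventually_elim
        case (elim R)
        have "of_real (b\<^sup>2) * \<i> + of_real (R * b) * of_real (1 / b) = of_real R + of_real (b\<^sup>2) * \<i>"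
          using b by simp
        moreover have "0 \<le> R * b"
          using elim b by simp
        note horizontal[OF this]
        ultimately have "exp (- (2 / 3) * b ^ 6) / b * integral {0..R * b} ?h
            = Re (G (of_real R + of_real (b\<^sup>2) * \<i>)) - Re (G (of_real (b\<^sup>2) * \<i>))"
          by (simp only:)
        moreover have "integral {0..R} ?f = Re (G (of_real R)) - Re (G 0)"
          using elim by (intro int_f) simp
        ultimately show ?case
          using vertical_0 vertical_R[OF elim] by (simp only: real_norm_def abs_le_iff) linarith
      qed
    qed
    ultimately show ?thesis
      by (rule Lim_transform)
  qed
  then have "(?f has_integral ?L) {0..}"
    by (intro has_integral_improper continuous_intros) auto
  then have "integral {0..} ?f = ?L"
    by (rule integral_unique)
  then show ?thesis
    by (simp add: Airy_Ai_def)
qed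

lemma tendsto_div_cube:
  fixes c :: real
  shows "((\<lambda>b. c / (3 * b ^ 3)) \<longlongrightarrow> 0) at_top"
  by real_asymp

lemma airy_gauss_tendsto: "(airy_gauss \<longlongrightarrow> sqrt pi / 2) at_top"
proof -
  have "((\<lambda>b. \<integral>t. indicator {0..} t *\<^sub>R (exp (- t\<^sup>2) * cos (t ^ 3 / (3 * b ^ 3))) \<partial>lborel)
    \<longlongrightarrow> (\<integral>t. indicator {0..} t *\<^sub>R exp (- t\<^sup>2) \<partial>lborel)) (at_top :: real filter)"
  proof (rule integral_dominated_convergence_at_top[where w = "\<lambda>t. indicator {0..} t *\<^sub>R exp (- t\<^sup>2)"])
    show "integrable lborel (\<lambda>t::real. indicator {0..} t *\<^sub>R exp (- t\<^sup>2))"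
      using gauss_half_line(1) by (simp add: set_integrable_def)
    have "((\<lambda>b. indicator {0..} t *\<^sub>R (exp (- t\<^sup>2) * cos (t ^ 3 / (3 * b ^ 3))))
        \<longlongrightarrow> indicator {0..} t *\<^sub>R (exp (- t\<^sup>2) * cos 0)) at_top" for t :: real
      by (intro tendsto_scaleR tendsto_mult tendsto_const tendsto_cos tendsto_div_cube)
    then show "AE t in lborel. ((\<lambda>b. indicator {0..} t *\<^sub>R (exp (- t\<^sup>2) * cos (t ^ 3 / (3 * b ^ 3))))
        \<longlongrightarrow> indicator {0..} t *\<^sub>R exp (- t\<^sup>2)) (at_top :: real filter)"
      by simp
    show "\<forall>\<^sub>F b in at_top. AE t in lborel. norm (indicator {0..} t *\<^sub>R (exp (- t\<^sup>2) * cos (t ^ 3 / (3 * b ^ 3))))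
        \<le> indicator {0..} t *\<^sub>R exp (- (t::real)\<^sup>2)"
      by (intro always_eventually allI AE_I2) (auto simp: abs_mult intro!: mult_left_le split: split_indicator)
  qed auto
  then show ?thesis
    using gauss_half_line(2) unfolding airy_gauss_def[abs_def] set_lebesgue_integral_def by metis
qed

text \<open>The classical Ai(x) ~ exp(-2/3 x^(3/2)) / (2 sqrt(pi) x^(1/4)) at x = b^4.\<close>

lemma Airy_Ai_asymp:
  "((\<lambda>b. Airy_Ai (b ^ 4) * (b * exp (2 / 3 * b ^ 6))) \<longlongrightarrow> 1 / (2 * sqrt pi)) at_top"
proof -
  have "((\<lambda>b. airy_gauss b / pi) \<longlongrightarrow> (sqrt pi / 2) / pi) at_top"
    by (intro tendsto_intros airy_gauss_tendsto) simp
  moreover have "(sqrt pi / 2) / pi = 1 / (2 * sqrt pi)"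
    by (simp add: field_simps)
  moreover have "\<forall>\<^sub>F b in at_top. airy_gauss b / pi = Airy_Ai (b ^ 4) * (b * exp (2 / 3 * b ^ 6))"
    using eventually_gt_at_top[of 0]
    by eventually_elim (simp add: Airy_Ai_steepest_descent field_simps flip: exp_add)
  ultimately show ?thesis
    by (simp add: tendsto_cong)
qed

section \<open>Laplace's method for the exponent of the connection integral\<close>

lemma gauss_integral: "has_bochner_integral lborel (\<lambda>t::real. exp (- t\<^sup>2)) (sqrt pi)"
  using has_bochner_integral_even_function[OF gaussian_moment_0] by simp

text \<open>
  The weights and the interval come from the substitution \<open>w = b\<^sup>2 / 2 + t / (2 * b)\<close>, which centres
  the exponent \<open>2 * b ^ 4 * w - 8 * w ^ 3 / 3\<close> at its maximum.
\<close>

lemma laplace_lebesgue: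
  assumes c: "\<And>b t. \<lbrakk>1 \<le> b; - (b ^ 3) \<le> t\<rbrakk> \<Longrightarrow> \<bar>c b t\<bar> \<le> 1 + \<bar>t\<bar>"
    and c_lim: "\<And>t. ((\<lambda>b. c b t) \<longlongrightarrow> 1) at_top"
    and [measurable]: "\<And>b. c b \<in> borel_measurable borel"
    and "0 < d"
  shows "((\<lambda>b. LBINT t:{- (b ^ 3)..d * b ^ 3}. c b t * exp (- t\<^sup>2 - t ^ 3 / (3 * b ^ 3)))
    \<longlongrightarrow> sqrt pi) at_top"
proof -
  \<comment> \<open>For t >= - b^3 the cubic term is at most t^2 / 3, which leaves exp(-t^2 / 2)
    exp(-t^2 / 6); the second factor absorbs the weight, since 1 + |t| <= 3 exp(t^2 / 6).\<close>
  let ?w = "\<lambda>t::real. 3 * exp (- t\<^sup>2 / 2)"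
  have "((\<lambda>b. \<integral>t. indicator {- (b ^ 3)..d * b ^ 3} t *\<^sub>R (c b t * exp (- t\<^sup>2 - t ^ 3 / (3 * b ^ 3))) \<partial>lborel)
    \<longlongrightarrow> (\<integral>t. exp (- t\<^sup>2) \<partial>lborel)) (at_top :: real filter)"
  proof (rule integral_dominated_convergence_at_top[where w = ?w])
    have "integrable lborel (\<lambda>t. 3 * sqrt (2 * pi) * std_normal_density t)"
      by (intro integrable_mult_right integrable_normal_density zero_less_one)
    then show "integrable lborel ?w"
      by (simp add: std_normal_density_def)
    have "((\<lambda>b. indicator {- (b ^ 3)..d * b ^ 3} t *\<^sub>R (c b t * exp (- t\<^sup>2 - t ^ 3 / (3 * b ^ 3))))
        \<longlongrightarrow> 1 *\<^sub>R (1 * exp (- t\<^sup>2 - 0))) at_top" for t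
    proof (intro tendsto_scaleR tendsto_mult tendsto_exp tendsto_diff tendsto_const tendsto_div_cube c_lim)
      have "\<forall>\<^sub>F b in at_top. - (b ^ 3) \<le> t" "\<forall>\<^sub>F b in at_top. t \<le> d * b ^ 3"
        using \<open>0 < d\<close> by real_asymp+
      then have "\<forall>\<^sub>F b in at_top. indicator {- (b ^ 3)..d * b ^ 3} t = (1::real)"
        by eventually_elim simp
      then show "((\<lambda>b. indicator {- (b ^ 3)..d * b ^ 3} t) \<longlongrightarrow> (1::real)) at_top"
        by (rule tendsto_eventually)
    qed
    then show "AE t in lborel. ((\<lambda>b. indicator {- (b ^ 3)..d * b ^ 3} t *\<^sub>R (c b t * exp (- t\<^sup>2 - t ^ 3 / (3 * b ^ 3))))
        \<longlongrightarrow> exp (- t\<^sup>2)) at_top"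
      by simp
    show "\<forall>\<^sub>F b in at_top. AE t in lborel.
      norm (indicator {- (b ^ 3)..d * b ^ 3} t *\<^sub>R (c b t * exp (- t\<^sup>2 - t ^ 3 / (3 * b ^ 3)))) \<le> ?w t"
      using eventually_ge_at_top[of 1]
    proof (eventually_elim, intro AE_I2)
      fix b t :: real assume b: "1 \<le> b"
      show "norm (indicator {- (b ^ 3)..d * b ^ 3} t *\<^sub>R (c b t * exp (- t\<^sup>2 - t ^ 3 / (3 * b ^ 3)))) \<le> ?w t"
      proof (cases "t \<in> {- (b ^ 3)..d * b ^ 3}")
        case True
        then have t: "- (b ^ 3) \<le> t" by simp
        have b3: "0 < b ^ 3" using b by simp
        have "t\<^sup>2 * - t \<le> t\<^sup>2 * b ^ 3"
          using t by (intro mult_left_mono) auto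
        then have "- (t ^ 3) / (3 * b ^ 3) \<le> t\<^sup>2 / 3"
          using b3 by (simp add: field_simps power3_eq_cube power2_eq_square)
        then have "- t\<^sup>2 - t ^ 3 / (3 * b ^ 3) \<le> - t\<^sup>2 / 2 - t\<^sup>2 / 6"
          by simp
        then have "exp (- t\<^sup>2 - t ^ 3 / (3 * b ^ 3)) \<le> exp (- t\<^sup>2 / 2) / exp (t\<^sup>2 / 6)"
          by (simp flip: exp_diff)
        moreover have "\<bar>c b t\<bar> \<le> 3 * exp (t\<^sup>2 / 6)"
        proof -
          have "0 \<le> (\<bar>t\<bar> - 1)\<^sup>2" by simp
          also have "\<dots> = t\<^sup>2 - 2 * \<bar>t\<bar> + 1"
            by (simp add: power2_diff)
          finally have "1 + \<bar>t\<bar> \<le> 3 * (1 + t\<^sup>2 / 6)"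
            by simp
          also have "\<dots> \<le> 3 * exp (t\<^sup>2 / 6)"
            by (intro mult_left_mono exp_ge_add_one_self) simp
          finally show ?thesis using c[OF b t] by simp
        qed
        ultimately have "\<bar>c b t\<bar> * exp (- t\<^sup>2 - t ^ 3 / (3 * b ^ 3)) \<le> 3 * exp (t\<^sup>2 / 6) * (exp (- t\<^sup>2 / 2) / exp (t\<^sup>2 / 6))"
          by (intro mult_mono) auto
        then show ?thesis
          using True by (simp add: abs_mult)
      qed simp
    qed
  qed measurable
  then show ?thesis
    using gauss_integral by (simp add: set_lebesgue_integral_def has_bochner_integral_iff)
qed

text \<open>The interval ends at the positive zero of the exponent, \<open>2 / 3 * b ^ 6\<close> is
  its maximum, taken at w = b^2 / 2, and \<open>c\<close> is the weight relative to 2 b^2.\<close>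

lemma laplace_integral:
  assumes c: "\<And>b t. \<lbrakk>1 \<le> b; - (b ^ 3) \<le> t\<rbrakk> \<Longrightarrow> \<bar>c b t\<bar> \<le> 1 + \<bar>t\<bar>"
    and c_lim: "\<And>t. ((\<lambda>b. c b t) \<longlongrightarrow> 1) at_top"
    and c_cont: "\<And>b. continuous_on UNIV (c b)"
    and g: "\<And>b w. 0 < b \<Longrightarrow> g b w = 2 * b\<^sup>2 * c b (2 * b * w - b ^ 3)"
  shows "((\<lambda>b. integral {0..sqrt 3 / 2 * b\<^sup>2} (\<lambda>w. g b w * exp (2 * b ^ 4 * w - 8 * w ^ 3 / 3))
    / (b * exp (2 / 3 * b ^ 6))) \<longlongrightarrow> sqrt pi) at_top"
proof -
  \<comment> \<open>The endpoint w = sqrt 3 / 2 b^2 corresponds to t = (sqrt 3 - 1) b^3, and w = 0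
    to t = - b^3.\<close>
  define d :: real where "d = sqrt 3 - 1"
  have "1 < sqrt (3::real)" by simp
  then have "0 < d" by (simp add: d_def)
  let ?J = "\<lambda>b. LBINT t:{- (b ^ 3)..d * b ^ 3}. c b t * exp (- t\<^sup>2 - t ^ 3 / (3 * b ^ 3))"
  have "\<forall>\<^sub>F b in at_top. ?J b = integral {0..sqrt 3 / 2 * b\<^sup>2} (\<lambda>w. g b w * exp (2 * b ^ 4 * w - 8 * w ^ 3 / 3))
    / (b * exp (2 / 3 * b ^ 6))"
    using eventually_gt_at_top[of 0]
  proof eventually_elim
    case (elim b)
    let ?f = "\<lambda>t. c b t * exp (- t\<^sup>2 - t ^ 3 / (3 * b ^ 3))"
    have cont: "continuous_on {- (b ^ 3)..d * b ^ 3} ?f"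
      using elim by (intro continuous_intros continuous_on_subset[OF c_cont]) auto
    have J: "?J b = integral {- (b ^ 3)..d * b ^ 3} ?f"
      by (rule set_borel_integral_eq_integral(2)) (use cont borel_integrable_atLeastAtMost' in blast)
    have "(?f has_integral ?J b) (cbox (- (b ^ 3)) (d * b ^ 3))"
      unfolding J cbox_interval using integrable_continuous_real[OF cont] by (rule integrable_integral)
    from has_integral_affinity'[OF this, of "2 * b" "- (b ^ 3)"]
    have "((\<lambda>w. ?f ((2 * b) *\<^sub>R w + - (b ^ 3))) has_integral ?J b /\<^sub>R (2 * b) ^ DIM(real))
        (cbox ((- (b ^ 3) - - (b ^ 3)) /\<^sub>R (2 * b)) ((d * b ^ 3 - - (b ^ 3)) /\<^sub>R (2 * b)))"
      using elim by simp
    moreover have "?J b /\<^sub>R (2 * b) ^ DIM(real) = ?J b / (2 * b)"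
      by (simp only: DIM_real power_one_right real_scaleR_def divide_inverse_commute)
    moreover have "cbox ((- (b ^ 3) - - (b ^ 3)) /\<^sub>R (2 * b)) ((d * b ^ 3 - - (b ^ 3)) /\<^sub>R (2 * b))
        = {0..sqrt 3 / 2 * b\<^sup>2}"
      using elim by (simp add: d_def field_simps power3_eq_cube power2_eq_square)
    moreover have "(2 * b) *\<^sub>R w + - (b ^ 3) = 2 * b * w - b ^ 3" for w
      by simp
    ultimately have "((\<lambda>w. ?f (2 * b * w - b ^ 3)) has_integral ?J b / (2 * b)) {0..sqrt 3 / 2 * b\<^sup>2}"
      by (simp only:)
    then have "((\<lambda>w. (2 * b\<^sup>2 * exp (2 / 3 * b ^ 6)) * ?f (2 * b * w - b ^ 3)) has_integral
        (2 * b\<^sup>2 * exp (2 / 3 * b ^ 6)) * (?J b / (2 * b))) {0..sqrt 3 / 2 * b\<^sup>2}"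
      by (rule has_integral_mult_right)
    moreover have "(2 * b\<^sup>2 * exp (2 / 3 * b ^ 6)) * ?f (2 * b * w - b ^ 3)
        = g b w * exp (2 * b ^ 4 * w - 8 * w ^ 3 / 3)" for w
    proof -
      define t where "t = 2 * b * w - b ^ 3"
      have w: "w = (t + b ^ 3) / (2 * b)"
        using elim by (simp add: t_def)
      have "2 / 3 * b ^ 6 + (- t\<^sup>2 - t ^ 3 / (3 * b ^ 3)) = 2 * b ^ 4 * w - 8 * w ^ 3 / 3"
      proof -
        have "8 * w ^ 3 = (t + b ^ 3) ^ 3 / b ^ 3"
          unfolding w using elim by (simp add: power_divide power_mult_distrib)
        also have "\<dots> = t ^ 3 / b ^ 3 + 3 * t\<^sup>2 + 3 * t * b ^ 3 + b ^ 6"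
          using elim by (simp add: field_simps) (simp add: eval_nat_numeral algebra_simps)
        finally have "8 * w ^ 3 = t ^ 3 / b ^ 3 + 3 * t\<^sup>2 + 3 * t * b ^ 3 + b ^ 6" .
        moreover have "t ^ 3 / (3 * b ^ 3) = (t ^ 3 / b ^ 3) / 3"
          by simp
        moreover have "2 * b ^ 4 * w = t * b ^ 3 + b ^ 6"
          unfolding w using elim by (simp add: field_simps) (simp add: eval_nat_numeral algebra_simps)
        ultimately show ?thesis by linarith
      qed
      then show ?thesis
        unfolding g[OF elim] t_def[symmetric] by (simp flip: exp_add)
    qed
    ultimately have "((\<lambda>w. g b w * exp (2 * b ^ 4 * w - 8 * w ^ 3 / 3)) has_integral
        (2 * b\<^sup>2 * exp (2 / 3 * b ^ 6)) * (?J b / (2 * b))) {0..sqrt 3 / 2 * b\<^sup>2}"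
      by (simp only:)
    then have "integral {0..sqrt 3 / 2 * b\<^sup>2} (\<lambda>w. g b w * exp (2 * b ^ 4 * w - 8 * w ^ 3 / 3))
        = (2 * b\<^sup>2 * exp (2 / 3 * b ^ 6)) * (?J b / (2 * b))"
      by (rule integral_unique)
    then show ?case
      using elim by (simp add: power2_eq_square)
  qed
  moreover have "(?J \<longlongrightarrow> sqrt pi) at_top"
    by (rule laplace_lebesgue[OF c c_lim _ \<open>0 < d\<close>]) (use c_cont borel_measurable_continuous_onI in auto)
  ultimately show ?thesis
    by (simp add: tendsto_cong)
qed

text \<open>The peak exp(2/3 b^6) cancels the decay of Ai, and sqrt(pi) times 1 / (2 sqrt(pi))
  leaves 1/2. The weights 4 w and 2 b^2 agree at the peak w = b^2 / 2; they stem from the terms with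
  u and with u' in the connection integral.\<close>

lemma Airy_laplace:
  "((\<lambda>b. Airy_Ai (b ^ 4) * integral {0..sqrt 3 / 2 * b\<^sup>2}
      (\<lambda>w. 4 * w * exp (2 * b ^ 4 * w - 8 * w ^ 3 / 3))) \<longlongrightarrow> 1 / 2) at_top"
  "((\<lambda>b. Airy_Ai (b ^ 4) * integral {0..sqrt 3 / 2 * b\<^sup>2}
      (\<lambda>w. 2 * b\<^sup>2 * exp (2 * b ^ 4 * w - 8 * w ^ 3 / 3))) \<longlongrightarrow> 1 / 2) at_top"
proof -
  have half: "1 / (2 * sqrt pi) * sqrt pi = 1 / 2"
    by simp
  have *: "((\<lambda>b. Airy_Ai (b ^ 4) * g b) \<longlongrightarrow> 1 / 2) at_top"
    if "((\<lambda>b. g b / (b * exp (2 / 3 * b ^ 6))) \<longlongrightarrow> sqrt pi) at_top" for g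
  proof -
    have "\<forall>\<^sub>F b in at_top. Airy_Ai (b ^ 4) * (b * exp (2 / 3 * b ^ 6)) * (g b / (b * exp (2 / 3 * b ^ 6)))
        = Airy_Ai (b ^ 4) * g b"
      using eventually_gt_at_top[of 0] by eventually_elim simp
    with tendsto_mult[OF Airy_Ai_asymp that] show ?thesis
      unfolding half by (simp add: tendsto_cong)
  qed
  show "((\<lambda>b. Airy_Ai (b ^ 4) * integral {0..sqrt 3 / 2 * b\<^sup>2}
      (\<lambda>w. 2 * b\<^sup>2 * exp (2 * b ^ 4 * w - 8 * w ^ 3 / 3))) \<longlongrightarrow> 1 / 2) at_top"
    by (intro * laplace_integral[where c = "\<lambda>_ _. 1"]) auto
  show "((\<lambda>b. Airy_Ai (b ^ 4) * integral {0..sqrt 3 / 2 * b\<^sup>2}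
      (\<lambda>w. 4 * w * exp (2 * b ^ 4 * w - 8 * w ^ 3 / 3))) \<longlongrightarrow> 1 / 2) at_top"
  proof (intro * laplace_integral[where c = "\<lambda>b t. 1 + t / b ^ 3"])
    fix b t :: real assume "1 \<le> b"
    then have "\<bar>t / b ^ 3\<bar> \<le> \<bar>t\<bar>"
      by (simp add: abs_divide divide_le_eq mult_le_cancel_left1 one_le_power)
    then show "\<bar>1 + t / b ^ 3\<bar> \<le> 1 + \<bar>t\<bar>"
      by linarith
  next
    show "((\<lambda>b. 1 + t / b ^ 3) \<longlongrightarrow> 1) at_top" for t :: real
      by real_asymp
    show "continuous_on UNIV (\<lambda>t. 1 + t / b ^ 3)" for b :: real
      by (cases "b = 0") (auto intro!: continuous_intros)
    show "4 * w = 2 * b\<^sup>2 * (1 + (2 * b * w - b ^ 3) / b ^ 3)" if "0 < b" for b w :: real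
      using that by (simp add: field_simps power3_eq_cube power2_eq_square)
  qed
qed

section \<open>The Hastings-McLeod solution at infinity\<close>

lemma filterlim_pow4_at_top: "filterlim (\<lambda>b::real. b ^ 4) at_top at_top"
  by real_asymp

lemma eventually_at_top_pow4:
  "eventually P at_top \<longleftrightarrow> eventually (\<lambda>b::real. P (b ^ 4)) at_top"
proof
  assume "eventually (\<lambda>b::real. P (b ^ 4)) at_top"
  then obtain B where B: "\<And>b. B \<le> b \<Longrightarrow> P (b ^ 4)"
    by (auto simp: eventually_at_top_linorder)
  have "P x" if "(max B 0) ^ 4 \<le> x" for x
  proof -
    have "0 \<le> x" using that by (rule order_trans[rotated]) simp
    have "max B 0 = root 4 (max B 0 ^ 4)"
      by (intro real_root_power_cancel[symmetric]) auto
    also have "\<dots> \<le> root 4 x"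
      using that by simp
    finally have "P (root 4 x ^ 4)" by (intro B) simp
    then show "P x" using \<open>0 \<le> x\<close> by simp
  qed
  then show "eventually P at_top"
    by (auto simp: eventually_at_top_linorder)
next
  assume "eventually P at_top"
  then show "eventually (\<lambda>b::real. P (b ^ 4)) at_top"
    using filterlim_pow4_at_top by (simp add: filterlim_iff)
qed

lemma tendsto_at_top_pow4:
  "(f \<longlongrightarrow> l) at_top \<longleftrightarrow> ((\<lambda>b::real. f (b ^ 4)) \<longlongrightarrow> l) at_top"
  unfolding tendsto_def by (subst eventually_at_top_pow4) simp

lemma Airy_Ai_pos: "\<forall>\<^sub>F x in at_top. 0 < Airy_Ai x"
proof -
  have "\<forall>\<^sub>F b in at_top. 0 < Airy_Ai (b ^ 4) * (b * exp (2 / 3 * b ^ 6))"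
    using Airy_Ai_asymp by (rule order_tendstoD) simp
  then have "\<forall>\<^sub>F b in at_top. 0 < Airy_Ai (b ^ 4)"
    using eventually_gt_at_top[of 0]
  proof eventually_elim
    case (elim b)
    then have "0 < b * exp (2 / 3 * b ^ 6)" by simp
    with elim(1) show ?case by (rule zero_less_mult_pos2)
  qed
  then show ?thesis
    by (subst eventually_at_top_pow4)
qed

lemma Airy_Ai_exp_decay: "((\<lambda>x. Airy_Ai x * exp x) \<longlongrightarrow> 0) at_top"
proof -
  have "((\<lambda>b::real. exp (b ^ 4) / (b * exp (2 / 3 * b ^ 6))) \<longlongrightarrow> 0) at_top"
    by real_asymp
  from tendsto_mult[OF Airy_Ai_asymp this]
  have "((\<lambda>b. Airy_Ai (b ^ 4) * (b * exp (2 / 3 * b ^ 6)) * (exp (b ^ 4) / (b * exp (2 / 3 * b ^ 6)))) \<longlongrightarrow> 0) at_top"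
    by simp
  moreover have "\<forall>\<^sub>F b in at_top. Airy_Ai (b ^ 4) * (b * exp (2 / 3 * b ^ 6)) * (exp (b ^ 4) / (b * exp (2 / 3 * b ^ 6)))
      = Airy_Ai (b ^ 4) * exp (b ^ 4)"
    using eventually_gt_at_top[of 0] by eventually_elim simp
  ultimately show ?thesis
    by (subst tendsto_at_top_pow4) (simp add: tendsto_cong)
qed

locale hastings_mcleod_solution =
  fixes u :: "real \<Rightarrow> real"
  assumes hm: "hastings_mcleod u"
begin

sublocale painleve_solution u
  using hm by unfold_locales (simp add: hastings_mcleod_def)

lemma u_over_Ai: "((\<lambda>x. - u x / Airy_Ai x) \<longlongrightarrow> 1) at_top"
proof -
  have "u \<sim>[at_top] (\<lambda>x. - Airy_Ai x)"
    using hm by (simp add: hastings_mcleod_def)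
  \<comment> \<open>Asymptotic equivalence reads 0 / 0 as 1; eventual positivity of Ai removes this
    default.\<close>
  then have "((\<lambda>x. if u x = 0 \<and> - Airy_Ai x = 0 then 1 else u x / - Airy_Ai x) \<longlongrightarrow> 1) at_top"
    by (rule asymp_equivD)
  moreover have "\<forall>\<^sub>F x in at_top. (if u x = 0 \<and> - Airy_Ai x = 0 then 1 else u x / - Airy_Ai x) = - u x / Airy_Ai x"
    using Airy_Ai_pos by eventually_elim simp
  ultimately show ?thesis
    by (simp add: tendsto_cong)
qed

lemma u_neg: "\<forall>\<^sub>F x in at_top. u x < 0"
proof -
  have "\<forall>\<^sub>F x in at_top. 0 < - u x / Airy_Ai x"
    using u_over_Ai by (rule order_tendstoD) simp
  with Airy_Ai_pos show ?thesis
    by eventually_elim (simp add: zero_less_divide_iff divide_less_0_iff)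
qed

lemma u_exp_decay: "((\<lambda>x. u x * exp x) \<longlongrightarrow> 0) at_top"
proof -
  have "((\<lambda>x. - ((- u x / Airy_Ai x) * (Airy_Ai x * exp x))) \<longlongrightarrow> - (1 * 0)) at_top"
    by (intro tendsto_minus tendsto_mult u_over_Ai Airy_Ai_exp_decay)
  moreover have "\<forall>\<^sub>F x in at_top. - ((- u x / Airy_Ai x) * (Airy_Ai x * exp x)) = u x * exp x"
    using Airy_Ai_pos by eventually_elim simp
  ultimately show ?thesis
    by (simp add: tendsto_cong)
qed

lemma u_le_exp: "\<forall>\<^sub>F x in at_top. \<bar>u x\<bar> \<le> exp (- x)"
proof -
  have "\<forall>\<^sub>F x in at_top. \<bar>u x * exp x\<bar> < 1"
    using tendstoD[OF u_exp_decay, of 1] by (simp add: dist_real_def)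
  then show ?thesis
    by eventually_elim (simp add: abs_mult exp_minus field_simps)
qed

lemma u_tendsto_0: "(u \<longlongrightarrow> 0) at_top"
proof (rule Lim_null_comparison)
  show "\<forall>\<^sub>F x in at_top. norm (u x) \<le> exp (- x)"
    using u_le_exp by simp
  show "((\<lambda>x::real. exp (- x)) \<longlongrightarrow> 0) at_top"
    by real_asymp
qed

text \<open>The relation u ~ -Ai cannot simply be differentiated, so the equation is used: for large
  x, u < 0 gives u'' < 0, and u' decreases. A nonpositive value of u' would then keep u away from
  its limit 0, and the mean value theorem on [x - 1, x] bounds u' by |u(x - 1)|.\<close>

lemma du_pos_and_decay:
  "\<forall>\<^sub>F x in at_top. 0 < deriv u x \<and> deriv u x \<le> exp (1 - x)"
proof -
  obtain X where X: "\<And>x. X \<le> x \<Longrightarrow> u x < 0 \<and> \<bar>u x\<bar> \<le> exp (- x) \<and> 1 \<le> x"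
    using eventually_conj[OF u_neg eventually_conj[OF u_le_exp eventually_ge_at_top[of 1]]]
    by (auto simp: eventually_at_top_linorder)
  have dd: "2 * u x ^ 3 + x * u x < 0" if "X \<le> x" for x
  proof -
    have "0 < 2 * (u x)\<^sup>2 + x" using X[OF that] by (smt (verit) zero_le_power2)
    then have "u x * (2 * (u x)\<^sup>2 + x) < 0" using X[OF that] by (simp add: mult_less_0_iff)
    then show ?thesis by (simp add: power3_eq_cube power2_eq_square algebra_simps)
  qed
  have decr: "deriv u b < deriv u a" if "X \<le> a" "a < b" for a b
  proof (rule DERIV_neg_imp_decreasing[OF \<open>a < b\<close>])
    fix x assume "a \<le> x" "x \<le> b"
    then show "\<exists>y. (deriv u has_real_derivative y) (at x) \<and> y < 0"
      using DERIV_du dd[of x] that by fastforce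
  qed
  have pos: "0 < deriv u a" if a: "X \<le> a" for a
  proof (rule ccontr)
    assume "\<not> 0 < deriv u a"
    then have neg: "deriv u x \<le> 0" if "a \<le> x" for x
      using decr[OF a, of x] that by (cases "x = a") auto
    have "u x \<le> u a" if "a \<le> x" for x
      by (rule DERIV_nonpos_imp_nonincreasing[OF that]) (use DERIV_u neg in blast)
    then have "\<forall>\<^sub>F x in at_top. u x \<le> u a"
      by (auto simp: eventually_at_top_linorder)
    then have "0 \<le> u a"
      by (rule tendsto_upperbound[OF u_tendsto_0]) simp
    then show False using X[OF a] by simp
  qed
  have "deriv u x \<le> exp (1 - x)" if x: "X + 1 \<le> x" for x
  proof -
    obtain z where z: "x - 1 < z" "z < x" "u x - u (x - 1) = (x - (x - 1)) * deriv u z"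
      using MVT2[of "x - 1" x u "deriv u"] DERIV_u by auto
    have "deriv u x < deriv u z"
      using x z by (intro decr) auto
    moreover have "deriv u z = u x - u (x - 1)" using z by simp
    moreover have "u x < 0" "\<bar>u (x - 1)\<bar> \<le> exp (- (x - 1))"
      using X[of x] X[of "x - 1"] x by auto
    ultimately show ?thesis by simp
  qed
  with pos show ?thesis
    by (auto simp: eventually_at_top_linorder intro!: exI[of _ "X + 1"])
qed

text \<open>A primitive of \<open>- u\<^sup>2\<close> that is explicit in \<open>u\<close> and \<open>u'\<close>, hence vanishes at infinity.\<close>

definition energy :: "real \<Rightarrow> real" where
  "energy x = (deriv u x)\<^sup>2 - x * (u x)\<^sup>2 - (u x) ^ 4"

lemma DERIV_energy: "(energy has_real_derivative - ((u x)\<^sup>2)) (at x)"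
  unfolding energy_def
  by (auto intro!: derivative_eq_intros DERIV_u DERIV_du)
    (simp add: power2_eq_square power3_eq_cube algebra_simps)

lemma energy_tendsto_0: "(energy \<longlongrightarrow> 0) at_top"
proof -
  have lim_du: "(deriv u \<longlongrightarrow> 0) at_top"
  proof (rule Lim_null_comparison)
    show "\<forall>\<^sub>F x in at_top. norm (deriv u x) \<le> exp (1 - x)"
      using du_pos_and_decay by eventually_elim simp
    show "((\<lambda>x::real. exp (1 - x)) \<longlongrightarrow> 0) at_top"
      by real_asymp
  qed
  have lim_xu: "((\<lambda>x. x * (u x)\<^sup>2) \<longlongrightarrow> 0) at_top"
  proof (rule Lim_null_comparison)
    show "\<forall>\<^sub>F x in at_top. norm (x * (u x)\<^sup>2) \<le> x * (exp (- x))\<^sup>2"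
      using u_le_exp eventually_ge_at_top[of 0]
    proof eventually_elim
      case (elim x)
      have "(u x)\<^sup>2 \<le> (exp (- x))\<^sup>2"
        using elim by (subst abs_le_square_iff[symmetric]) (simp only: abs_exp_cancel)
      then show ?case using elim by (simp add: abs_mult mult_left_mono)
    qed
    show "((\<lambda>x::real. x * (exp (- x))\<^sup>2) \<longlongrightarrow> 0) at_top"
      by real_asymp
  qed
  show ?thesis
    using tendsto_diff[OF tendsto_diff[OF tendsto_power[OF lim_du, of 2] lim_xu] tendsto_power[OF u_tendsto_0, of 4]]
    by (simp add: energy_def[abs_def])
qed

text \<open>Positivity of \<open>energy\<close> gives the lower bound. The upper one says that
  \<open>energy\<close> is at most u^2 / (2 sqrt x), the size of the tail integral of u^2 suggested
  by u' ~ - sqrt x u; their difference \<open>H\<close> increases to 0, by the lower bound.\<close>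

lemma du_bounds:
  "\<forall>\<^sub>F x in at_top. x * (u x)\<^sup>2 \<le> (deriv u x)\<^sup>2
     \<and> (deriv u x)\<^sup>2 \<le> x * (u x)\<^sup>2 + (u x) ^ 4 + (u x)\<^sup>2 / (2 * sqrt x)"
proof -
  obtain X where X: "\<And>x. X \<le> x \<Longrightarrow> u x < 0 \<and> 1 \<le> x \<and> 0 < deriv u x"
    using eventually_conj[OF u_neg eventually_conj[OF eventually_ge_at_top[of 1] du_pos_and_decay]]
    by (auto simp: eventually_at_top_linorder)
  have Gpos: "0 < energy x" if "X \<le> x" for x
  proof (rule DERIV_neg_imp_decreasing_at_top[OF _ energy_tendsto_0])
    show "\<exists>y. (energy has_real_derivative y) (at x') \<and> y < 0" if "x \<le> x'" for x'
      using DERIV_energy[of x'] X[of x'] that \<open>X \<le> x\<close> by (intro exI[of _ "- ((u x')\<^sup>2)"]) auto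
  qed
  have sq: "x * (u x)\<^sup>2 \<le> (deriv u x)\<^sup>2" if "X \<le> x" for x
  proof -
    have "0 \<le> (u x) ^ 4" by simp
    with Gpos[OF that] show ?thesis unfolding energy_def by linarith
  qed
  define H where "H x = energy x - (u x)\<^sup>2 / (2 * sqrt x)" for x
  have dH: "\<exists>y. (H has_real_derivative y) (at x) \<and> 0 < y" if "X \<le> x" for x
  proof -
    have x: "1 \<le> x" "u x < 0" "0 < deriv u x" using X[OF that] by auto
    let ?s = "sqrt x"
    have s: "0 < ?s" "?s * ?s = x" using x by auto
    have "(H has_real_derivative - ((u x)\<^sup>2) - ((2 * u x * deriv u x) * (2 * ?s) - (u x)\<^sup>2 * (2 * (inverse ?s / 2))) / (2 * ?s * (2 * ?s))) (at x)"
      unfolding H_def using x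
      by (auto intro!: derivative_eq_intros DERIV_energy DERIV_u)
    moreover have "0 < - ((u x)\<^sup>2) - ((2 * u x * deriv u x) * (2 * ?s) - (u x)\<^sup>2 * (2 * (inverse ?s / 2))) / (2 * ?s * (2 * ?s))"
    proof -
      have "sqrt (x * (u x)\<^sup>2) \<le> sqrt ((deriv u x)\<^sup>2)"
        using sq[OF that] by (rule real_sqrt_le_mono)
      then have "?s * - u x \<le> deriv u x"
        using x by (simp add: real_sqrt_mult)
      then have "- u x * (?s * - u x) \<le> - u x * deriv u x"
        using x by (intro mult_left_mono) auto
      then have "(u x)\<^sup>2 \<le> - u x * deriv u x / ?s"
        using s by (simp add: field_simps power2_eq_square)
      moreover have "((2 * u x * deriv u x) * (2 * ?s) - (u x)\<^sup>2 * (2 * (inverse ?s / 2))) / (2 * ?s * (2 * ?s))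
        = u x * deriv u x / ?s - (u x)\<^sup>2 * inverse ?s / (4 * (?s * ?s))"
        using s(1) by (simp add: field_simps)
      moreover have "0 < (u x)\<^sup>2 * inverse ?s / (4 * (?s * ?s))"
        using s x by simp
      ultimately show ?thesis by simp
    qed
    ultimately show ?thesis by blast
  qed
  have "((\<lambda>x. (u x)\<^sup>2 / (2 * sqrt x)) \<longlongrightarrow> 0) at_top"
  proof -
    have "((\<lambda>x. 1 / (2 * sqrt x)) \<longlongrightarrow> 0) at_top" by real_asymp
    from tendsto_mult[OF tendsto_power[OF u_tendsto_0, of 2] this] show ?thesis by simp
  qed
  then have lim_H: "(H \<longlongrightarrow> 0) at_top"
    unfolding H_def using tendsto_diff[OF energy_tendsto_0] by fastforce
  have Hneg: "H x < 0" if "X \<le> x" for x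
  proof -
    have "- 0 < - H x"
      by (rule DERIV_neg_imp_decreasing_at_top[OF _ tendsto_minus[OF lim_H]])
        (use dH that in \<open>metis DERIV_minus neg_less_0_iff_less order_trans\<close>)
    then show ?thesis by simp
  qed
  show ?thesis
    using eventually_ge_at_top[of X]
  proof eventually_elim
    case (elim x)
    show ?case
      using sq[OF elim] Hneg[OF elim] by (simp add: H_def energy_def)
  qed
qed

lemma u_du_le: "\<forall>\<^sub>F x in at_top. sqrt x * - u x \<le> deriv u x"
  using du_bounds u_neg du_pos_and_decay eventually_ge_at_top[of 0]
proof eventually_elim
  case (elim x)
  from elim(1) have "sqrt (x * (u x)\<^sup>2) \<le> sqrt ((deriv u x)\<^sup>2)"
    by (intro real_sqrt_le_mono) simp
  then show ?case
    using elim by (simp add: real_sqrt_mult)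
qed

lemma du_over_u: "((\<lambda>x. deriv u x / (sqrt x * - u x)) \<longlongrightarrow> 1) at_top"
proof (rule real_tendsto_sandwich)
  let ?r = "\<lambda>x. deriv u x / (sqrt x * - u x)"
  have one: "\<forall>\<^sub>F x in at_top. 1 \<le> ?r x"
    using u_du_le u_neg eventually_gt_at_top[of 0]
  proof eventually_elim
    case (elim x)
    then have "0 < sqrt x * - u x" by (simp add: mult_pos_neg)
    from pos_le_divide_eq[OF this, of 1 "deriv u x"] elim(1) show ?case by simp
  qed
  then show "\<forall>\<^sub>F x in at_top. 1 \<le> ?r x" .
  show "\<forall>\<^sub>F x in at_top. ?r x \<le> 1 + (u x)\<^sup>2 / x + 1 / (2 * sqrt x * x)"
    using one du_bounds u_neg eventually_gt_at_top[of 0]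
  proof eventually_elim
    case (elim x)
    have p: "0 < x * (u x)\<^sup>2" using elim by simp
    \<comment> \<open>The ratio is at least 1, hence at most its square, to which
      \<open>du_bounds\<close> applies directly.\<close>
    have "?r x \<le> (?r x)\<^sup>2"
      using elim(1) self_le_power[of "?r x" 2] by simp
    also have "\<dots> = (deriv u x)\<^sup>2 / (x * (u x)\<^sup>2)"
      using elim by (simp add: power_divide power_mult_distrib)
    also have "\<dots> \<le> (x * (u x)\<^sup>2 + (u x) ^ 4 + (u x)\<^sup>2 / (2 * sqrt x)) / (x * (u x)\<^sup>2)"
      using elim p by (intro divide_right_mono) auto
    also have "\<dots> = 1 + (u x)\<^sup>2 / x + 1 / (2 * sqrt x * x)"
      using elim by (simp add: add_divide_distrib power2_eq_square power4_eq_xxxx)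
    finally show ?case .
  qed
  have "((\<lambda>x. 1 / x) \<longlongrightarrow> (0::real)) at_top" "((\<lambda>x. 1 / (2 * sqrt x * x)) \<longlongrightarrow> (0::real)) at_top"
    by real_asymp+
  from tendsto_add[OF tendsto_add[OF tendsto_const[of 1] tendsto_mult[OF tendsto_power[OF u_tendsto_0, of 2] this(1)]] this(2)]
  show "((\<lambda>x. 1 + (u x)\<^sup>2 / x + 1 / (2 * sqrt x * x)) \<longlongrightarrow> 1) at_top"
    by simp
qed simp

text \<open>The amplitude of u decides here: the term with u contributes 1/2 through u / Ai, and the
  term with u' contributes the other 1/2, after replacing u' by - sqrt x u.\<close>

lemma connection_integral_tendsto:
  "((\<lambda>b. integral {0..sqrt 3 / 2 * b\<^sup>2}
      (\<lambda>w. (2 * deriv u (b ^ 4) - 4 * w * u (b ^ 4)) * exp (2 * b ^ 4 * w - 8 * w ^ 3 / 3))) \<longlongrightarrow> 1) at_top"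
proof -
  let ?A = "\<lambda>b. integral {0..sqrt 3 / 2 * b\<^sup>2} (\<lambda>w. 4 * w * exp (2 * b ^ 4 * w - 8 * w ^ 3 / 3))"
  let ?B = "\<lambda>b. integral {0..sqrt 3 / 2 * b\<^sup>2} (\<lambda>w. 2 * b\<^sup>2 * exp (2 * b ^ 4 * w - 8 * w ^ 3 / 3))"
  let ?q = "\<lambda>x. - u x / Airy_Ai x" and ?r = "\<lambda>x. deriv u x / (sqrt x * - u x)"
  have q: "((\<lambda>b. ?q (b ^ 4)) \<longlongrightarrow> 1) at_top" and r: "((\<lambda>b. ?r (b ^ 4)) \<longlongrightarrow> 1) at_top"
    using u_over_Ai du_over_u
      tendsto_at_top_pow4[of ?q 1] tendsto_at_top_pow4[of ?r 1] by blast+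
  have "((\<lambda>b. ?q (b ^ 4) * (Airy_Ai (b ^ 4) * ?A b) + (?r (b ^ 4) * ?q (b ^ 4)) * (Airy_Ai (b ^ 4) * ?B b))
      \<longlongrightarrow> 1 * (1 / 2) + (1 * 1) * (1 / 2)) at_top"
    by (intro tendsto_add tendsto_mult q r Airy_laplace)
  moreover have "\<forall>\<^sub>F b in at_top.
      ?q (b ^ 4) * (Airy_Ai (b ^ 4) * ?A b) + (?r (b ^ 4) * ?q (b ^ 4)) * (Airy_Ai (b ^ 4) * ?B b)
      = integral {0..sqrt 3 / 2 * b\<^sup>2}
      (\<lambda>w. (2 * deriv u (b ^ 4) - 4 * w * u (b ^ 4)) * exp (2 * b ^ 4 * w - 8 * w ^ 3 / 3))"
    using Airy_Ai_pos[unfolded eventually_at_top_pow4[of "\<lambda>x. 0 < Airy_Ai x"]]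
      u_neg[unfolded eventually_at_top_pow4[of "\<lambda>x. u x < 0"]] eventually_gt_at_top[of 0]
  proof eventually_elim
    case (elim b)
    let ?S = "{0..sqrt 3 / 2 * b\<^sup>2}"
    let ?e = "\<lambda>w. exp (2 * b ^ 4 * w - 8 * w ^ 3 / 3)"
    have sq: "sqrt (b ^ 4) = b\<^sup>2"
      by (rule real_sqrt_unique) (simp_all flip: power_mult)
    have "integral ?S (\<lambda>w. (2 * deriv u (b ^ 4) - 4 * w * u (b ^ 4)) * ?e w)
        = integral ?S (\<lambda>w. (deriv u (b ^ 4) / b\<^sup>2) * (2 * b\<^sup>2 * ?e w) + (- u (b ^ 4)) * (4 * w * ?e w))"
      using elim by (intro arg_cong[where f = "integral ?S"] ext) (simp add: algebra_simps)
    also have "\<dots> = integral ?S (\<lambda>w. (deriv u (b ^ 4) / b\<^sup>2) * (2 * b\<^sup>2 * ?e w))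
        + integral ?S (\<lambda>w. (- u (b ^ 4)) * (4 * w * ?e w))"
      by (intro integral_add integrable_continuous_real continuous_intros) auto
    also have "\<dots> = (deriv u (b ^ 4) / b\<^sup>2) * ?B b + (- u (b ^ 4)) * ?A b"
      by (simp only: integral_mult_right)
    also have "\<dots> = ?q (b ^ 4) * (Airy_Ai (b ^ 4) * ?A b) + (?r (b ^ 4) * ?q (b ^ 4)) * (Airy_Ai (b ^ 4) * ?B b)"
      using elim unfolding sq by simp
    finally show ?case by simp
  qed
  ultimately show ?thesis
    by (simp add: tendsto_cong)
qed

end

section \<open>Recessive solutions for large x\<close>

lemma antiderivative_exists:
  fixes f :: "real \<Rightarrow> real"
  assumes "continuous_on UNIV f"
  shows "\<exists>F. \<forall>x. (F has_real_derivative f x) (at x)"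
proof -
  have "\<exists>F. \<forall>x::real. (- \<infinity> :: ereal) < ereal x \<longrightarrow> ereal x < \<infinity> \<longrightarrow> (F has_vector_derivative f x) (at x)"
    by (rule einterval_antiderivative) (use assms in \<open>auto simp: continuous_on_eq_continuous_at\<close>)
  then show ?thesis
    by (simp add: has_real_derivative_iff_has_vector_derivative)
qed

text \<open>
  The coefficients are those of the spectral equation of the Painleve II Lax pair, written for
  the sum and the difference of the two components.
\<close>

locale lax_ode =
  fixes x u v :: real and p q :: "real \<Rightarrow> real"
  assumes DERIV_p: "(p has_real_derivative
      (x + 2 * u\<^sup>2 - 4 * w\<^sup>2) * p w - (4 * w * u + 2 * v) * q w) (at w)"
    and DERIV_q: "(q has_real_derivative
      (2 * v - 4 * w * u) * p w - (x + 2 * u\<^sup>2 - 4 * w\<^sup>2) * q w) (at w)"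
    and p_lim: "(p \<longlongrightarrow> 0) at_top"
    and q_lim: "(q \<longlongrightarrow> 0) at_top"
begin

text \<open>A cone argument: \<open>T\<close> is nonincreasing beyond \<open>W\<close> and tends to
  0 along the recessive solution, so it is nonnegative at \<open>W\<close>.\<close>

lemma tail_bound:
  assumes eps: "0 < \<epsilon>" and "0 \<le> W"
    and le: "\<And>w. W \<le> w \<Longrightarrow>
      (1 + \<epsilon>\<^sup>2) * (4 * w * \<bar>u\<bar> + 2 * \<bar>v\<bar>) \<le> \<epsilon> * (8 * w\<^sup>2 - 2 * x - 4 * u\<^sup>2)"
  shows "\<bar>q W\<bar> \<le> \<epsilon> * \<bar>p W\<bar>"
proof -
  define T where "T w = \<epsilon>\<^sup>2 * (p w)\<^sup>2 - (q w)\<^sup>2" for w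
  define A where "A w = x + 2 * u\<^sup>2 - 4 * w\<^sup>2" for w
  define T' where "T' w = \<epsilon>\<^sup>2 * (2 * p w * (A w * p w - (4 * w * u + 2 * v) * q w))
      - 2 * q w * ((2 * v - 4 * w * u) * p w - A w * q w)" for w
  have DT: "(T has_real_derivative T' w) (at w)" for w
    unfolding T_def T'_def A_def by (auto intro!: derivative_eq_intros DERIV_p DERIV_q)
  have "T' w \<le> 0" if w: "W \<le> w" for w
  proof -
    let ?P = "\<epsilon> * \<bar>p w\<bar>" and ?Q = "\<bar>q w\<bar>" and ?M = "4 * w * \<bar>u\<bar> + 2 * \<bar>v\<bar>"
    have w0: "0 \<le> w" using w \<open>0 \<le> W\<close> by simp
    have "\<bar>4 * w * u + 2 * v\<bar> \<le> ?M"
      using abs_triangle_ineq[of "4 * w * u" "2 * v"] w0 by (simp add: abs_mult)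
    moreover have "\<bar>2 * v - 4 * w * u\<bar> \<le> ?M"
      using abs_triangle_ineq4[of "2 * v" "4 * w * u"] w0 by (simp add: abs_mult)
    ultimately have "\<bar>(\<epsilon>\<^sup>2 * (4 * w * u + 2 * v) + (2 * v - 4 * w * u)) * (p w * q w)\<bar>
        \<le> (\<epsilon>\<^sup>2 * ?M + ?M) * (\<bar>p w\<bar> * ?Q)"
      unfolding abs_mult[of _ "p w * q w"] abs_mult[of "p w"]
      by (intro mult_right_mono order_trans[OF abs_triangle_ineq] add_mono)
        (auto simp: abs_mult mult_left_mono)
    moreover have "T' w = 2 * A w * (?P\<^sup>2 + ?Q\<^sup>2)
        - 2 * ((\<epsilon>\<^sup>2 * (4 * w * u + 2 * v) + (2 * v - 4 * w * u)) * (p w * q w))"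
      by (simp add: T'_def power_mult_distrib) (simp add: algebra_simps power2_eq_square)
    moreover have "2 * ((1 + \<epsilon>\<^sup>2) * ?M) * (\<bar>p w\<bar> * ?Q) = 2 * ((\<epsilon>\<^sup>2 * ?M + ?M) * (\<bar>p w\<bar> * ?Q))"
      by (simp add: algebra_simps)
    ultimately have "T' w \<le> 2 * A w * (?P\<^sup>2 + ?Q\<^sup>2) + 2 * ((1 + \<epsilon>\<^sup>2) * ?M) * (\<bar>p w\<bar> * ?Q)"
      by linarith
    \<comment> \<open>The hypothesis is shaped so that the cross term completes the square in 2 A (P
      - Q)^2, where A <= 0.\<close>
    also have "2 * ((1 + \<epsilon>\<^sup>2) * ?M) * (\<bar>p w\<bar> * ?Q) \<le> 2 * (\<epsilon> * (8 * w\<^sup>2 - 2 * x - 4 * u\<^sup>2)) * (\<bar>p w\<bar> * ?Q)"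
      using le[OF w] by (intro mult_right_mono mult_left_mono) auto
    also have "\<dots> = - 4 * A w * (?P * ?Q)"
      by (simp add: A_def algebra_simps)
    finally have "T' w \<le> 2 * A w * (?P - ?Q)\<^sup>2"
      by (simp add: power2_diff algebra_simps)
    also have "\<dots> \<le> 0"
    proof -
      have "0 \<le> (1 + \<epsilon>\<^sup>2) * ?M"
        using w0 by (intro mult_nonneg_nonneg add_nonneg_nonneg) auto
      then have "0 \<le> \<epsilon> * (8 * w\<^sup>2 - 2 * x - 4 * u\<^sup>2)"
        using le[OF w] by linarith
      then have "A w \<le> 0"
        using eps by (simp add: A_def zero_le_mult_iff)
      then show ?thesis
        by (simp add: mult_nonpos_nonneg)
    qed
    finally show ?thesis .
  qed
  then have "T w \<le> T W" if "W \<le> w" for w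
    by (intro DERIV_nonpos_imp_nonincreasing[OF that]) (use DT in blast)
  then have "\<forall>\<^sub>F w in at_top. T w \<le> T W"
    by (auto simp: eventually_at_top_linorder)
  moreover have "(T \<longlongrightarrow> 0) at_top"
    unfolding T_def using p_lim q_lim by (auto intro!: tendsto_eq_intros)
  ultimately have "0 \<le> T W"
    using tendsto_upperbound trivial_limit_at_top_linorder by blast
  then have "(q W)\<^sup>2 \<le> (\<epsilon> * p W)\<^sup>2"
    by (simp add: T_def power_mult_distrib)
  then show ?thesis
    using eps by (simp add: abs_le_square_iff[symmetric] abs_mult)
qed

text \<open>
  Let \<open>a\<close> and \<open>c\<close> be \<open>p\<close> and \<open>q\<close> with the exponential factors of the free equation removed. To
  leading order \<open>a\<close> is constant and \<open>c\<close> changes by \<open>I * a\<close> over \<open>{0..W}\<close>, where \<open>W\<close> is the positive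
  zero of the free exponent.
\<close>

lemma head_bound:
  fixes b W m I :: real
  assumes x: "x = b ^ 4" and b: "2 \<le> b" and W: "W = sqrt 3 / 2 * b\<^sup>2"
    and u: "u \<le> 0" and v: "0 < v"
    and m: "m = (\<bar>u\<bar> + \<bar>v\<bar>) * (1 + W)\<^sup>2" and m_le: "m \<le> 1 / 100"
    and I: "I = integral {0..W} (\<lambda>w. (2 * v - 4 * w * u) * exp (2 * b ^ 4 * w - 8 * w ^ 3 / 3))"
    and I_le: "\<bar>1 - I\<bar> \<le> 1 / 10"
  shows "\<bar>p 0 + q 0\<bar> \<le> (\<bar>1 - I\<bar> + 35 * m) * \<bar>p 0 - q 0\<bar>"
proof -
  \<comment> \<open>The primitive of b^4 - 4 w^2, half the exponent in \<open>I\<close>. It vanishes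
    at 0 and at \<open>W\<close>, so \<open>a\<close> and \<open>c\<close> agree with
    \<open>p\<close> and \<open>q\<close> at both ends.\<close>
  define \<theta> where "\<theta> w = b ^ 4 * w - 4 * w ^ 3 / 3" for w
  define a where "a w = p w * exp (- \<theta> w)" for w
  define c where "c w = q w * exp (\<theta> w)" for w
  define j where "j w = (2 * v - 4 * w * u) * exp (2 * \<theta> w)" for w
  define \<epsilon> where "\<epsilon> = \<bar>u\<bar> + \<bar>v\<bar>"
  have b4: "b ^ 4 = 4 / 3 * W\<^sup>2"
    by (simp add: W power_mult_distrib power_divide flip: power_mult)
  have W2: "2 \<le> W"
  proof -
    have "1 < sqrt (3::real)" by simp
    moreover have "2\<^sup>2 \<le> b\<^sup>2" using b by (intro power_mono) auto
    ultimately have "1 * 4 \<le> sqrt 3 * b\<^sup>2" by (intro mult_mono) auto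
    then show ?thesis by (simp add: W)
  qed
  have eps: "0 < \<epsilon>" using v by (simp add: \<epsilon>_def)
  have grow: "\<epsilon> \<le> m" "\<epsilon> * W \<le> m" "\<epsilon> * W\<^sup>2 \<le> m"
    using eps W2 unfolding m \<epsilon>_def[symmetric]
    by (auto simp: power2_eq_square algebra_simps add_nonneg_nonneg mult_nonneg_nonneg)
  have m0: "0 < m" using eps grow by linarith
  have uv: "\<bar>u\<bar> \<le> \<epsilon>" "\<bar>v\<bar> \<le> \<epsilon>" by (simp_all add: \<epsilon>_def)
  have eps1: "\<epsilon> \<le> 1" using grow m_le by linarith
  have u2: "u\<^sup>2 \<le> \<epsilon>" 
  proof -
    have "\<bar>u\<bar> * \<bar>u\<bar> \<le> 1 * \<epsilon>" using uv eps1 by (intro mult_mono) auto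
    then show ?thesis by (simp add: power2_eq_square)
  qed
  \<comment> \<open>Beyond \<open>W\<close> one has x <= 4/3 w^2, so the damping 8 w^2 - 2 x - 4 u^2
    is at least 4 w^2, whereas the coupling is at most \<open>\<epsilon> * (4 * w)\<close>.\<close>
  have cW: "\<bar>q W\<bar> \<le> \<epsilon> * \<bar>p W\<bar>"
  proof (rule tail_bound[OF eps])
    fix w assume w: "W \<le> w"
    have w2: "2 \<le> w" and "W\<^sup>2 \<le> w\<^sup>2" using w W2 by (auto intro: power_mono)
    then have x4: "x \<le> 4 / 3 * w\<^sup>2" using b4 x by simp
    have "2 * \<bar>v\<bar> \<le> 4 * w * \<bar>v\<bar>"
      using w2 by (intro mult_right_mono) simp_all
    then have M: "4 * w * \<bar>u\<bar> + 2 * \<bar>v\<bar> \<le> \<epsilon> * (4 * w)"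
      by (simp add: \<epsilon>_def algebra_simps)
    have "\<epsilon>\<^sup>2 \<le> 1" using eps eps1 by (simp add: power_le_one)
    then have "(1 + \<epsilon>\<^sup>2) * (4 * w * \<bar>u\<bar> + 2 * \<bar>v\<bar>) \<le> 2 * (\<epsilon> * (4 * w))"
      using M w2 by (intro mult_mono) auto
    also have "\<dots> = \<epsilon> * (4 * (2 * w))" by simp
    also have "\<dots> \<le> \<epsilon> * (4 * (w * w))"
      using eps w2 by (intro mult_left_mono mult_right_mono) auto
    also have "\<dots> \<le> \<epsilon> * (8 * w\<^sup>2 - 2 * x - 4 * u\<^sup>2)"
    proof (intro mult_left_mono)
      have "4 \<le> w\<^sup>2" using power_mono[OF w2, of 2] by simp
      moreover have "u\<^sup>2 \<le> 1" using u2 eps1 by simp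
      ultimately show "4 * (w * w) \<le> 8 * w\<^sup>2 - 2 * x - 4 * u\<^sup>2"
        using x4 unfolding power2_eq_square[symmetric] by linarith
    qed (use eps in simp)
    finally show "(1 + \<epsilon>\<^sup>2) * (4 * w * \<bar>u\<bar> + 2 * \<bar>v\<bar>) \<le> \<epsilon> * (8 * w\<^sup>2 - 2 * x - 4 * u\<^sup>2)" .
  qed (use W2 in simp)
  have theta_W: "\<theta> W = 0"
    by (simp add: \<theta>_def b4 power2_eq_square power3_eq_cube)
  have theta_nonneg: "0 \<le> \<theta> w" if "0 \<le> w" "w \<le> W" for w
  proof -
    have "w * w\<^sup>2 \<le> w * W\<^sup>2" using that by (intro mult_left_mono power_mono) auto
    then show ?thesis by (simp add: \<theta>_def b4 power3_eq_cube power2_eq_square mult.commute mult.left_commute)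
  qed
  have D\<theta>: "(\<theta> has_real_derivative b ^ 4 - 4 * w\<^sup>2) (at w)" for w
    unfolding \<theta>_def by (auto intro!: derivative_eq_intros simp: power2_eq_square)
  have Da: "(a has_real_derivative 2 * u\<^sup>2 * a w - (4 * w * u + 2 * v) * (exp (- 2 * \<theta> w) * c w)) (at w)" for w
  proof -
    have "(a has_real_derivative ((x + 2 * u\<^sup>2 - 4 * w\<^sup>2) * p w - (4 * w * u + 2 * v) * q w) * exp (- \<theta> w)
        + (exp (- \<theta> w) * - (b ^ 4 - 4 * w\<^sup>2)) * p w) (at w)"
      unfolding a_def by (intro DERIV_mult DERIV_p DERIV_fun_exp DERIV_minus D\<theta>)
    moreover have "exp (- 2 * \<theta> w) * c w = exp (- \<theta> w) * q w"
      by (simp add: c_def flip: exp_add)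
    ultimately show ?thesis
      by (elim DERIV_cong) (simp add: a_def x algebra_simps)
  qed
  have Dc: "(c has_real_derivative j w * a w - 2 * u\<^sup>2 * c w) (at w)" for w
  proof -
    have "(c has_real_derivative ((2 * v - 4 * w * u) * p w - (x + 2 * u\<^sup>2 - 4 * w\<^sup>2) * q w) * exp (\<theta> w)
        + (exp (\<theta> w) * (b ^ 4 - 4 * w\<^sup>2)) * q w) (at w)"
      unfolding c_def by (intro DERIV_mult DERIV_q DERIV_fun_exp D\<theta>)
    moreover have "j w * a w = (2 * v - 4 * w * u) * (exp (\<theta> w) * p w)"
      by (simp add: j_def a_def flip: exp_add)
    ultimately show ?thesis
      by (elim DERIV_cong) (simp add: c_def x algebra_simps)
  qed
  have j_nonneg: "0 \<le> j w" if "0 \<le> w" for w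
  proof -
    have "w * u \<le> 0" using that u by (rule mult_nonneg_nonpos)
    then have "0 \<le> 2 * v - 4 * w * u" using v by linarith
    then show ?thesis by (simp add: j_def)
  qed
  have cont_theta: "continuous_on UNIV \<theta>"
    unfolding \<theta>_def by (intro continuous_intros) auto
  have "continuous_on UNIV j"
    unfolding j_def by (intro continuous_intros cont_theta)
  then obtain J where DJ: "\<And>w. (J has_real_derivative j w) (at w)"
    using antiderivative_exists by blast
  have IJ: "J W - J 0 = I"
  proof -
    have "(j has_integral J W - J 0) {0..W}"
      using W2 DJ by (intro fundamental_theorem_of_calculus)
        (auto simp flip: has_real_derivative_iff_has_vector_derivative intro: has_field_derivative_at_within)
    moreover have "j = (\<lambda>w. (2 * v - 4 * w * u) * exp (2 * b ^ 4 * w - 8 * w ^ 3 / 3))"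
      by (auto simp: j_def \<theta>_def)
    ultimately show ?thesis
      unfolding I by (simp add: integral_unique)
  qed
  have J_mono: "J w \<le> J w'" if "0 \<le> w" "w \<le> w'" for w w'
    by (rule DERIV_nonneg_imp_nondecreasing[OF that(2)]) (use DJ j_nonneg that in fastforce)
  have I_bounds: "0 \<le> I" "I \<le> 11 / 10"
    using I_le by linarith+
  obtain Na where Na: "\<And>w. \<lbrakk>0 \<le> w; w \<le> W\<rbrakk> \<Longrightarrow> \<bar>a w\<bar> \<le> Na" and "\<exists>w. 0 \<le> w \<and> w \<le> W \<and> Na = \<bar>a w\<bar>"
  proof -
    have "continuous_on {0..W} (\<lambda>w. \<bar>a w\<bar>)"
      by (intro continuous_intros continuous_at_imp_continuous_on) (use Da DERIV_isCont in blast)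
    from continuous_attains_sup[OF _ _ this] W2 that show ?thesis by fastforce
  qed
  obtain Nc where Nc: "\<And>w. \<lbrakk>0 \<le> w; w \<le> W\<rbrakk> \<Longrightarrow> \<bar>c w\<bar> \<le> Nc" and Nc_att: "\<exists>w. 0 \<le> w \<and> w \<le> W \<and> Nc = \<bar>c w\<bar>"
  proof -
    have "continuous_on {0..W} (\<lambda>w. \<bar>c w\<bar>)"
      by (intro continuous_intros continuous_at_imp_continuous_on) (use Dc DERIV_isCont in blast)
    from continuous_attains_sup[OF _ _ this] W2 that show ?thesis by fastforce
  qed
  have N0: "0 \<le> Na" "0 \<le> Nc"
    using Na[of 0] Nc[of 0] W2 by auto
  have "u\<^sup>2 * W \<le> \<epsilon> * W"
    using u2 W2 by (intro mult_right_mono) auto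
  then have u2W: "2 * u\<^sup>2 * W \<le> 2 * m" using grow by linarith
  have cW': "\<bar>c W\<bar> \<le> m * Na"
  proof -
    have "\<bar>c W\<bar> \<le> \<epsilon> * \<bar>a W\<bar>" using cW by (simp add: a_def c_def theta_W)
    also have "\<dots> \<le> m * Na" using grow eps Na[of W] W2 by (intro mult_mono) auto
    finally show ?thesis .
  qed
  \<comment> \<open>Running back from \<open>W\<close>, where \<open>c\<close> is small,
    \<open>c\<close> picks up at most \<open>Na * I\<close> plus a small multiple of
    \<open>Nc\<close>, which is absorbed on the left; 3 is a generous constant.\<close>
  have Nc_le: "Nc \<le> 3 * Na"
  proof -
    obtain w where w: "0 \<le> w" "w \<le> W" "Nc = \<bar>c w\<bar>" using Nc_att by blast
    have "\<bar>c W - c w\<bar> \<le> (Na * J W + 2 * u\<^sup>2 * Nc * W) - (Na * J w + 2 * u\<^sup>2 * Nc * w)"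
    proof (rule abs_diff_le_of_deriv_le[OF w(2) Dc])
      fix t assume t: "w \<le> t" "t \<le> W"
      show "((\<lambda>t. Na * J t + 2 * u\<^sup>2 * Nc * t) has_real_derivative Na * j t + 2 * u\<^sup>2 * Nc) (at t)"
        by (auto intro!: derivative_eq_intros DJ)
      have "\<bar>j t * a t\<bar> \<le> j t * Na"
        using t w Na[of t] j_nonneg[of t] by (simp add: abs_mult mult_left_mono)
      moreover have "\<bar>2 * u\<^sup>2 * c t\<bar> \<le> 2 * u\<^sup>2 * Nc"
        using t w Nc[of t] by (simp add: abs_mult mult_left_mono)
      ultimately show "\<bar>j t * a t - 2 * u\<^sup>2 * c t\<bar> \<le> Na * j t + 2 * u\<^sup>2 * Nc"
        by (simp add: mult.commute)
    qed
    also have "\<dots> = Na * (J W - J w) + (2 * u\<^sup>2 * (W - w)) * Nc"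
      by (simp add: algebra_simps)
    also have "\<dots> \<le> Na * I + (2 * m) * Nc"
    proof (intro add_mono mult_left_mono mult_right_mono N0)
      show "J W - J w \<le> I" using IJ J_mono[of 0 w] w by simp
      have "2 * u\<^sup>2 * (W - w) \<le> 2 * u\<^sup>2 * W" using w by (intro mult_left_mono) auto
      then show "2 * u\<^sup>2 * (W - w) \<le> 2 * m" using u2W by simp
    qed
    also have "\<dots> \<le> Na * (11 / 10) + 1 / 50 * Nc"
      using I_bounds m_le by (intro add_mono mult_left_mono mult_right_mono N0) auto
    finally have "Nc \<le> \<bar>c W\<bar> + Na * (11 / 10) + 1 / 50 * Nc"
      using w(3) by linarith
    moreover have "m * Na \<le> 1 / 100 * Na" using m_le N0 by (intro mult_right_mono)
    ultimately show ?thesis using cW' N0 by linarith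
  qed
  \<comment> \<open>The feedback of \<open>c\<close> on \<open>a\<close> carries exp(-2 \<theta>) <=
    1. The constant is 14 = 2 + 4 * 3, from the u^2 term and from |c| <= 3 Na.\<close>
  have a_osc: "\<bar>a w - a 0\<bar> \<le> 14 * m * Na" if w: "0 \<le> w" "w \<le> W" for w
  proof -
    let ?K = "2 * u\<^sup>2 * Na + \<epsilon> * (4 * W) * (3 * Na)"
    have "\<bar>a w - a 0\<bar> \<le> ?K * w - ?K * 0"
    proof (rule abs_diff_le_of_deriv_le[OF w(1) Da])
      fix t assume t: "0 \<le> t" "t \<le> w"
      show "((\<lambda>t. ?K * t) has_real_derivative ?K) (at t)"
        by (auto intro!: derivative_eq_intros)
      have "\<bar>2 * u\<^sup>2 * a t\<bar> \<le> 2 * u\<^sup>2 * Na"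
        using t w Na[of t] by (simp add: abs_mult mult_left_mono)
      moreover have "\<bar>(4 * t * u + 2 * v) * (exp (- 2 * \<theta> t) * c t)\<bar> \<le> \<epsilon> * (4 * W) * (1 * (3 * Na))"
        unfolding abs_mult
      proof (intro mult_mono)
        have "4 * t * \<bar>u\<bar> \<le> 4 * W * \<bar>u\<bar>"
          using t w by (intro mult_right_mono) simp_all
        moreover have "2 * \<bar>v\<bar> \<le> 4 * W * \<bar>v\<bar>"
          using W2 by (intro mult_right_mono) simp_all
        moreover have "\<bar>4 * t * u + 2 * v\<bar> \<le> 4 * t * \<bar>u\<bar> + 2 * \<bar>v\<bar>"
          using abs_triangle_ineq[of "4 * t * u" "2 * v"] t by (simp add: abs_mult)
        ultimately show "\<bar>4 * t * u + 2 * v\<bar> \<le> \<epsilon> * (4 * W)"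
          by (simp add: \<epsilon>_def algebra_simps)
        show "\<bar>exp (- 2 * \<theta> t)\<bar> \<le> 1" using theta_nonneg[of t] t w by simp
        show "\<bar>c t\<bar> \<le> 3 * Na" using Nc[of t] Nc_le t w by simp
      qed (use eps W2 in auto)
      ultimately show "\<bar>2 * u\<^sup>2 * a t - (4 * t * u + 2 * v) * (exp (- 2 * \<theta> t) * c t)\<bar> \<le> ?K"
        by linarith
    qed
    also have "\<dots> \<le> ?K * W"
      using w N0 eps W2 by (simp add: mult_left_mono add_nonneg_nonneg)
    also have "\<dots> = (2 * u\<^sup>2 * W) * Na + 12 * (\<epsilon> * W\<^sup>2) * Na"
      by (simp add: algebra_simps power2_eq_square)
    also have "\<dots> \<le> (2 * m) * Na + 12 * m * Na"
      using u2W grow N0 by (intro add_mono mult_right_mono mult_left_mono) auto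
    finally show ?thesis by (simp add: algebra_simps)
  qed
  \<comment> \<open>Freezing \<open>a\<close> at \<open>a 0\<close> costs 14 * 11/10, the u^2 term 6
    and the value at \<open>W\<close> 1, all times \<open>m * Na\<close>; 35 leaves room.\<close>
  have main: "\<bar>c 0 + I * a 0\<bar> \<le> 35 * m * Na"
  proof -
    let ?K = "14 * m * Na"
    have "\<bar>(c W - J W * a 0) - (c 0 - J 0 * a 0)\<bar>
        \<le> (?K * J W + 2 * u\<^sup>2 * (3 * Na) * W) - (?K * J 0 + 2 * u\<^sup>2 * (3 * Na) * 0)"
    proof (rule abs_diff_le_of_deriv_le[where f = "\<lambda>w. c w - J w * a 0"])
      fix t assume t: "0 \<le> t" "t \<le> W"
      show "((\<lambda>w. c w - J w * a 0) has_real_derivative (j t * a t - 2 * u\<^sup>2 * c t) - j t * a 0) (at t)"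
        by (intro DERIV_diff Dc DERIV_cmult_right DJ)
      show "((\<lambda>t. ?K * J t + 2 * u\<^sup>2 * (3 * Na) * t) has_real_derivative ?K * j t + 2 * u\<^sup>2 * (3 * Na)) (at t)"
        by (auto intro!: derivative_eq_intros DJ)
      have "\<bar>j t * (a t - a 0)\<bar> \<le> j t * ?K"
        using j_nonneg[of t] a_osc[of t] t by (simp add: abs_mult mult_left_mono)
      moreover have "\<bar>2 * u\<^sup>2 * c t\<bar> \<le> 2 * u\<^sup>2 * (3 * Na)"
        unfolding abs_mult[of "2 * u\<^sup>2"] using Nc[of t] Nc_le t by (intro mult_mono) auto
      moreover have "(j t * a t - 2 * u\<^sup>2 * c t) - j t * a 0 = j t * (a t - a 0) - 2 * u\<^sup>2 * c t"
        by (simp add: algebra_simps)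
      ultimately show "\<bar>(j t * a t - 2 * u\<^sup>2 * c t) - j t * a 0\<bar> \<le> ?K * j t + 2 * u\<^sup>2 * (3 * Na)"
        unfolding mult.commute[of "j t" ?K] by linarith
    qed (use W2 in simp)
    also have "\<dots> = ?K * I + (2 * u\<^sup>2 * W) * (3 * Na)"
      by (simp add: IJ[symmetric] algebra_simps)
    also have "\<dots> \<le> ?K * (11 / 10) + (2 * m) * (3 * Na)"
      using I_bounds u2W N0 m0 by (intro add_mono mult_left_mono mult_right_mono) auto
    also have "\<dots> = 107 / 5 * (m * Na)" by simp
    finally have "\<bar>(c W - J W * a 0) - (c 0 - J 0 * a 0)\<bar> \<le> 107 / 5 * (m * Na)" .
    moreover have "(c W - J W * a 0) - (c 0 - J 0 * a 0) = c W - (c 0 + I * a 0)"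
      unfolding IJ[symmetric] by (simp add: algebra_simps)
    moreover have "0 \<le> m * Na" using m0 N0 by simp
    ultimately show ?thesis
      using cW' unfolding mult.assoc by linarith
  qed
  define \<delta> where "\<delta> = \<bar>1 - I\<bar> + 35 * m"
  have p0: "p 0 = a 0" "q 0 = c 0" by (simp_all add: a_def c_def \<theta>_def)
  have S: "\<bar>a 0 + c 0\<bar> \<le> \<delta> * Na"
  proof -
    have "\<bar>(1 - I) * a 0\<bar> \<le> \<bar>1 - I\<bar> * Na"
      using Na[of 0] W2 by (simp add: abs_mult mult_left_mono)
    moreover have "a 0 + c 0 = (1 - I) * a 0 + (c 0 + I * a 0)"
      by (simp add: algebra_simps)
    moreover have "\<delta> * Na = \<bar>1 - I\<bar> * Na + 35 * m * Na"
      by (simp add: \<delta>_def algebra_simps)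
    ultimately show ?thesis
      using main by linarith
  qed
  \<comment> \<open>In absolute value \<open>a 0\<close> is at least 86/100 of \<open>Na\<close> and
    \<open>a 0 + c 0\<close> at most half of it, so a 0 - c 0 = 2 a 0 - (a 0 + c 0) is large
    enough.\<close>
  have "Na \<le> \<bar>a 0 - c 0\<bar>"
  proof -
    obtain w where w: "0 \<le> w" "w \<le> W" "Na = \<bar>a w\<bar>"
      using \<open>\<exists>w. 0 \<le> w \<and> w \<le> W \<and> Na = \<bar>a w\<bar>\<close> by blast
    have "14 * m * Na \<le> 14 / 100 * Na"
      using m_le N0 by (intro mult_right_mono) auto
    then have "Na \<le> \<bar>a 0\<bar> + 14 / 100 * Na"
      using a_osc[OF w(1,2)] w(3) by linarith
    moreover have "\<delta> * Na \<le> 1 / 2 * Na"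
      using m_le I_le N0 by (intro mult_right_mono) (auto simp: \<delta>_def)
    ultimately show ?thesis using S by linarith
  qed
  moreover have "0 \<le> \<delta>" using m0 by (simp add: \<delta>_def)
  ultimately have "\<delta> * Na \<le> \<delta> * \<bar>a 0 - c 0\<bar>"
    by (rule mult_left_mono)
  with S show ?thesis
    unfolding p0 \<delta>_def[symmetric] by linarith
qed

end

section \<open>Recessive sections of the Lax pair\<close>

context painleve_lax
begin

lemma lax_coeff_linear:
  "lax_coeff (\<lambda>e. s * k e + t * k' e) e n x = s * lax_coeff k e n x + t * lax_coeff k' e n x"
proof (induction k e n x rule: lax_coeff.induct)
  case (4 k e n x)
  then show ?case
    by (simp add: lax_coeff.simps(4) diff_divide_distrib add_divide_distrib algebra_simps)
qed (simp_all add: lax_coeff.simps diff_divide_distrib add_divide_distrib algebra_simps)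

lemma lax_linear:
  assumes "e = 1 \<or> e = - 1"
  shows "lax (\<lambda>e. s * k e + t * k' e) e w x = s * lax k e w x + t * lax k' e w x"
proof -
  have "(\<lambda>n. s * (lax_coeff k e n x * w ^ n) + t * (lax_coeff k' e n x * w ^ n)) sums
      (s * lax k e w x + t * lax k' e w x)"
    unfolding lax_def using assms
    by (intro sums_add sums_mult summable_sums summable_lax)
  then show ?thesis
    unfolding lax_def lax_coeff_linear by (simp add: sums_iff algebra_simps)
qed

abbreviation S :: "(real \<Rightarrow> real) \<Rightarrow> real \<Rightarrow> real \<Rightarrow> real" where
  "S k \<equiv> lax k 1"

abbreviation D :: "(real \<Rightarrow> real) \<Rightarrow> real \<Rightarrow> real \<Rightarrow> real" where
  "D k \<equiv> lax k (- 1)"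

lemma DERIV_S: "((\<lambda>w. S k w x) has_real_derivative
    (Y 1 x - 4 * w\<^sup>2) * D k w x - 4 * w * u x * S k w x) (at w)"
  using DERIV_lax_w[of 1 k x w] by simp

lemma DERIV_D: "((\<lambda>w. D k w x) has_real_derivative
    (Y (- 1) x - 4 * w\<^sup>2) * S k w x + 4 * w * u x * D k w x) (at w)"
  using DERIV_lax_w[of "- 1" k x w] by simp

lemma DERIV_S_x: "((\<lambda>x. S k w x) has_real_derivative w * D k w x + u x * S k w x) (at x)"
  using DERIV_lax_x[of 1 k w x] by simp

lemma DERIV_D_x: "((\<lambda>x. D k w x) has_real_derivative w * S k w x - u x * D k w x) (at x)"
  using DERIV_lax_x[of "- 1" k w x] by simp

lemma DERIV_SD: "((\<lambda>w. S k w x * D k w x) has_real_derivative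
    (Y 1 x - 4 * w\<^sup>2) * (D k w x)\<^sup>2 + (Y (- 1) x - 4 * w\<^sup>2) * (S k w x)\<^sup>2) (at w)"
  by (rule DERIV_cong[OF DERIV_mult[OF DERIV_S DERIV_D]]) (simp add: algebra_simps power2_eq_square)

lemma SD_antimono:
  assumes "Y 1 x \<le> 0" "Y (- 1) x \<le> 0" "0 \<le> w" "w \<le> w'"
  shows "S k w' x * D k w' x \<le> S k w x * D k w x"
proof (rule DERIV_nonpos_imp_nonincreasing[OF \<open>w \<le> w'\<close>])
  fix t
  have "(Y 1 x - 4 * t\<^sup>2) * (D k t x)\<^sup>2 + (Y (- 1) x - 4 * t\<^sup>2) * (S k t x)\<^sup>2 \<le> 0"
    using assms by (intro add_nonpos_nonpos mult_nonpos_nonneg) (auto intro: order_trans)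
  then show "\<exists>y. ((\<lambda>w. S k w x * D k w x) has_real_derivative y) (at t) \<and> y \<le> 0"
    using DERIV_SD by blast
qed

text \<open>For each n some unit initial vector gives S = 0 at w = n, and monotonicity makes S D
  nonnegative on [0, n]; a limit of these vectors serves the whole half-line. If its S D were 0 at w
  = 0, it would vanish for all w >= 0; the derivative, a sum of nonpositive terms, would force S = D
  = 0 and thus a zero vector.\<close>

lemma exists_nonneg_section:
  assumes Y: "Y 1 x \<le> 0" "Y (- 1) x \<le> 0"
  obtains k where "0 < k 1 * k (- 1)" "\<And>w. 0 \<le> w \<Longrightarrow> 0 \<le> S k w x * D k w x"
proof -
  define k1 k2 :: "real \<Rightarrow> real" where "k1 e = (if e = 1 then 1 else 0)" and "k2 e = (if e = 1 then 0 else 1)" for e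
  define K where "K c = (\<lambda>e. fst c * k1 e + snd c * k2 e)" for c :: "real \<times> real"
  have SD_K: "S (K c) w x = fst c * S k1 w x + snd c * S k2 w x"
    "D (K c) w x = fst c * D k1 w x + snd c * D k2 w x" for c w
    unfolding K_def by (rule lax_linear, simp)+
  have "\<exists>c \<in> sphere 0 1. S (K c) (real n) x = 0" for n :: nat
  proof -
    define \<alpha> \<beta> where "\<alpha> = S k1 (real n) x" and "\<beta> = S k2 (real n) x"
    show ?thesis
    proof (cases "(\<beta>, - \<alpha>) = 0")
      case True
      then show ?thesis
        by (intro bexI[of _ "(1, 0)"]) (simp_all add: SD_K \<alpha>_def zero_prod_def dist_Pair_Pair)
    next
      case False
      \<comment> \<open>This vector spans the kernel of the linear form sending c to
        \<open>S (K c) (real n) x\<close>.\<close>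
      define v where "v = (\<beta>, - \<alpha>)"
      have "S (K (v /\<^sub>R norm v)) (real n) x = 0"
        by (simp add: SD_K v_def flip: \<alpha>_def \<beta>_def)
      moreover have "v /\<^sub>R norm v \<in> sphere 0 1"
        using False unfolding v_def[symmetric] by simp
      ultimately show ?thesis by blast
    qed
  qed
  then obtain c where c: "\<And>n. c n \<in> sphere 0 1" "\<And>n :: nat. S (K (c n)) (real n) x = 0"
    by metis
  have "compact (sphere (0 :: real \<times> real) 1)" by simp
  then obtain l r where l: "l \<in> sphere 0 1" "strict_mono r" "(c \<circ> r) \<longlonglongrightarrow> l"
    using c(1) unfolding compact_def by metis
  have nonneg: "0 \<le> S (K l) w x * D (K l) w x" if w: "0 \<le> w" for w
  proof (rule tendsto_lowerbound)
    have c1: "(\<lambda>n. fst (c (r n))) \<longlonglongrightarrow> fst l" "(\<lambda>n. snd (c (r n))) \<longlonglongrightarrow> snd l"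
      using tendsto_fst[OF l(3)] tendsto_snd[OF l(3)] by (simp_all add: o_def)
    show "(\<lambda>n. S (K (c (r n))) w x * D (K (c (r n))) w x) \<longlonglongrightarrow> S (K l) w x * D (K l) w x"
      unfolding SD_K by (intro tendsto_intros c1)
    obtain N :: nat where N: "w \<le> real N" using real_arch_simple by blast
    have "0 \<le> S (K (c (r n))) w x * D (K (c (r n))) w x" if "N \<le> n" for n
    proof -
      have "real n \<le> real (r n)" using seq_suble[OF l(2)] by simp
      then have "w \<le> real (r n)" using N that by simp
      from SD_antimono[OF Y w this, of "K (c (r n))"] show ?thesis
        by (simp add: c(2))
    qed
    then show "\<forall>\<^sub>F n in sequentially. 0 \<le> S (K (c (r n))) w x * D (K (c (r n))) w x"
      by (auto simp: eventually_sequentially)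
  qed simp
  have K_l: "K l 1 = fst l" "K l (- 1) = snd l"
    by (simp_all add: K_def k1_def k2_def)
  have SD0: "S (K l) 0 x * D (K l) 0 x = K l 1 * K l (- 1)"
    by (simp add: lax_0 exp_minus)
  have "K l 1 * K l (- 1) \<noteq> 0"
  proof
    assume "K l 1 * K l (- 1) = 0"
    with SD0 SD_antimono[OF Y order_refl, of _ "K l"] nonneg
    have zero: "S (K l) w x * D (K l) w x = 0" if "0 \<le> w" for w
      using that by (metis order_antisym)
    have "S (K l) w x = 0 \<and> D (K l) w x = 0" if w: "0 < w" for w
    proof -
      let ?d = "(Y 1 x - 4 * w\<^sup>2) * (D (K l) w x)\<^sup>2 + (Y (- 1) x - 4 * w\<^sup>2) * (S (K l) w x)\<^sup>2"
      have "\<forall>\<^sub>F t in nhds w. 0 < t"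
        using eventually_nhds_in_open[of "{0<..}" w] w by simp
      then have "\<forall>\<^sub>F t in nhds w. S (K l) t x * D (K l) t x = 0"
        by eventually_elim (simp add: zero)
      from DERIV_cong_ev[OF refl this refl, of ?d]
      have "((\<lambda>_. 0) has_real_derivative ?d) (at w)"
        using DERIV_SD[of "K l" x w] by (rule iffD1)
      then have d: "?d = 0"
        by (rule DERIV_unique) (rule DERIV_const)
      have "0 < 4 * w\<^sup>2" using w by simp
      then have neg: "Y 1 x - 4 * w\<^sup>2 < 0" "Y (- 1) x - 4 * w\<^sup>2 < 0"
        using Y by linarith+
      then have "(Y 1 x - 4 * w\<^sup>2) * (D (K l) w x)\<^sup>2 \<le> 0" "(Y (- 1) x - 4 * w\<^sup>2) * (S (K l) w x)\<^sup>2 \<le> 0"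
        by (intro mult_nonpos_nonneg; simp)+
      with d have "(Y 1 x - 4 * w\<^sup>2) * (D (K l) w x)\<^sup>2 = 0" "(Y (- 1) x - 4 * w\<^sup>2) * (S (K l) w x)\<^sup>2 = 0"
        by linarith+
      with neg show ?thesis by auto
    qed
    then have ev: "\<forall>\<^sub>F w in at_right 0. S (K l) w x = 0" "\<forall>\<^sub>F w in at_right 0. D (K l) w x = 0"
      by (auto simp: eventually_at_filter)
    have lims: "((\<lambda>w. S (K l) w x) \<longlongrightarrow> S (K l) 0 x) (at_right 0)" "((\<lambda>w. D (K l) w x) \<longlongrightarrow> D (K l) 0 x) (at_right 0)"
      using DERIV_isCont[OF DERIV_S] DERIV_isCont[OF DERIV_D]
      by (auto simp: isCont_def intro: tendsto_mono[OF at_le])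
    have "S (K l) 0 x = 0"
      by (rule tendsto_unique[OF _ lims(1) tendsto_eventually[OF ev(1)]]) simp
    moreover have "D (K l) 0 x = 0"
      by (rule tendsto_unique[OF _ lims(2) tendsto_eventually[OF ev(2)]]) simp
    ultimately have "l = 0"
      by (simp add: lax_0 K_l prod_eq_iff)
    with l(1) show False by simp
  qed
  moreover have "0 \<le> K l 1 * K l (- 1)"
    using nonneg[of 0] SD0 by simp
  ultimately have "0 < K l 1 * K l (- 1)"
    by (metis less_le)
  with nonneg show ?thesis
    using that by blast
qed

text \<open>Gronwall's inequality: the matrix of the x-equation is symmetric with norm at most w +
  M, so transport in x costs an exponential whose exponent is only linear in w.\<close>

lemma section_norm_growth:
  assumes "x0 \<le> x" "0 \<le> w" and M: "\<And>t. \<lbrakk>x0 \<le> t; t \<le> x\<rbrakk> \<Longrightarrow> \<bar>u t\<bar> \<le> M"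
  shows "(S k w x)\<^sup>2 + (D k w x)\<^sup>2 \<le> ((S k w x0)\<^sup>2 + (D k w x0)\<^sup>2) * exp (2 * (w + M) * (x - x0))"
proof -
  let ?N = "\<lambda>t. (S k w t)\<^sup>2 + (D k w t)\<^sup>2"
  let ?f = "\<lambda>t. ?N t * exp (- 2 * (w + M) * t)"
  have "?f x \<le> ?f x0"
  proof (rule DERIV_nonpos_imp_nonincreasing[OF \<open>x0 \<le> x\<close>])
    fix t assume t: "x0 \<le> t" "t \<le> x"
    let ?s = "S k w t" and ?d = "D k w t"
    have "((\<lambda>t. ?N t) has_real_derivative 2 * ?s * (w * ?d + u t * ?s) + 2 * ?d * (w * ?s - u t * ?d)) (at t)"
      by (auto intro!: derivative_eq_intros DERIV_S_x DERIV_D_x)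
    moreover have "((\<lambda>t. exp (- 2 * (w + M) * t)) has_real_derivative exp (- 2 * (w + M) * t) * (- 2 * (w + M))) (at t)"
      by (auto intro!: derivative_eq_intros)
    ultimately have d: "(?f has_real_derivative
        (2 * ?s * (w * ?d + u t * ?s) + 2 * ?d * (w * ?s - u t * ?d)) * exp (- 2 * (w + M) * t)
        + exp (- 2 * (w + M) * t) * (- 2 * (w + M)) * ?N t) (at t)"
      by (rule DERIV_mult)
    have e: "(2 * ?s * (w * ?d + u t * ?s) + 2 * ?d * (w * ?s - u t * ?d)) * exp (- 2 * (w + M) * t)
        + exp (- 2 * (w + M) * t) * (- 2 * (w + M)) * ?N t
      = exp (- 2 * (w + M) * t) * (- 2 * (w * (?s - ?d)\<^sup>2 + (M - u t) * ?s\<^sup>2 + (M + u t) * ?d\<^sup>2))"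
      by (simp add: algebra_simps power2_eq_square)
    have n: "exp (- 2 * (w + M) * t) * (- 2 * (w * (?s - ?d)\<^sup>2 + (M - u t) * ?s\<^sup>2 + (M + u t) * ?d\<^sup>2)) \<le> 0"
    proof (rule mult_nonneg_nonpos)
      have "0 \<le> M - u t" "0 \<le> M + u t"
        using M[OF t] by linarith+
      with \<open>0 \<le> w\<close> have "0 \<le> w * (?s - ?d)\<^sup>2" "0 \<le> (M - u t) * ?s\<^sup>2" "0 \<le> (M + u t) * ?d\<^sup>2"
        by (auto intro: mult_nonneg_nonneg)
      then show "- 2 * (w * (?s - ?d)\<^sup>2 + (M - u t) * ?s\<^sup>2 + (M + u t) * ?d\<^sup>2) \<le> 0"
        by simp
    qed simp
    show "\<exists>y. (?f has_real_derivative y) (at t) \<and> y \<le> 0"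
      using d n unfolding e by blast
  qed
  then have "?N x * exp (- 2 * (w + M) * x) * exp (2 * (w + M) * x)
      \<le> ?N x0 * exp (- 2 * (w + M) * x0) * exp (2 * (w + M) * x)"
    by (rule mult_right_mono) simp
  moreover have "exp (- 2 * (w + M) * x) * exp (2 * (w + M) * x) = 1"
    unfolding mult_exp_exp by (simp add: algebra_simps)
  moreover have "exp (- 2 * (w + M) * x0) * exp (2 * (w + M) * x) = exp (2 * (w + M) * (x - x0))"
    unfolding mult_exp_exp by (simp add: algebra_simps)
  ultimately show ?thesis
    by (simp only: mult.assoc mult_1_right)
qed

text \<open>S D >= 0 means |S - D| <= |S + D|, so in the equation for S + D the coupling is of order
  w and the damping - 4 w^2 wins.\<close>

lemma nonneg_section_decay:
  assumes nonneg: "\<And>w. 0 \<le> w \<Longrightarrow> 0 \<le> S k w x * D k w x"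
  shows "((\<lambda>w. ((S k w x)\<^sup>2 + (D k w x)\<^sup>2) * exp (C * w)) \<longlongrightarrow> 0) at_top"
proof -
  define P where "P w = S k w x + D k w x" for w
  define Q where "Q w = S k w x - D k w x" for w
  define A where "A w = x + 2 * (u x)\<^sup>2 - 4 * w\<^sup>2" for w
  define B where "B w = 4 * w * u x + 2 * deriv u x" for w
  have DP: "(P has_real_derivative A w * P w - B w * Q w) (at w)" for w
    unfolding P_def
    by (rule DERIV_cong[OF DERIV_add[OF DERIV_S DERIV_D]])
      (simp add: A_def B_def P_def Q_def Y_def algebra_simps)
  have QP: "\<bar>Q w\<bar> \<le> \<bar>P w\<bar>" if "0 \<le> w" for w
  proof -
    have "(P w)\<^sup>2 - (Q w)\<^sup>2 = 4 * (S k w x * D k w x)"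
      by (simp add: P_def Q_def algebra_simps power2_eq_square)
    with nonneg[OF that] show ?thesis
      by (simp add: abs_le_square_iff)
  qed
  \<comment> \<open>The extra 1 in \<open>C + 1\<close> leaves a factor exp(- w), which turns
    boundedness into convergence to 0.\<close>
  let ?f = "\<lambda>w. (P w)\<^sup>2 * exp ((C + 1) * w)"
  obtain W where W: "\<And>w. W \<le> w \<Longrightarrow> 2 * A w + 2 * (4 * w * \<bar>u x\<bar> + 2 * \<bar>deriv u x\<bar>) + (C + 1) \<le> 0"
  proof -
    define c d where "c = 8 * \<bar>u x\<bar>" and "d = 2 * x + 4 * (u x)\<^sup>2 + 4 * \<bar>deriv u x\<bar> + C + 1"
    have "2 * A w + 2 * (4 * w * \<bar>u x\<bar> + 2 * \<bar>deriv u x\<bar>) + (C + 1) \<le> 0"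
      if w: "max 1 (c + \<bar>d\<bar>) \<le> w" for w
    proof -
      have "\<bar>d\<bar> * 1 \<le> \<bar>d\<bar> * w" using w by (intro mult_left_mono) auto
      then have "c * w + d \<le> (c + \<bar>d\<bar>) * w" by (simp add: algebra_simps)
      also have "\<dots> \<le> w * w" using w by (intro mult_right_mono) auto
      also have "\<dots> \<le> 8 * w\<^sup>2" by (simp add: power2_eq_square)
      finally show ?thesis by (simp add: A_def c_def d_def algebra_simps)
    qed
    then show ?thesis by (rule that)
  qed
  define W0 where "W0 = max W 0"
  have "?f w \<le> ?f W0" if "W0 \<le> w" for w
  proof (rule DERIV_nonpos_imp_nonincreasing[OF that])
    fix t assume "W0 \<le> t" "t \<le> w"
    then have t: "W \<le> t" "0 \<le> t" by (auto simp: W0_def)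
    have d: "(?f has_real_derivative 2 * P t * (A t * P t - B t * Q t) * exp ((C + 1) * t)
        + exp ((C + 1) * t) * (C + 1) * (P t)\<^sup>2) (at t)"
      by (auto intro!: derivative_eq_intros DP)
    have e: "2 * P t * (A t * P t - B t * Q t) * exp ((C + 1) * t) + exp ((C + 1) * t) * (C + 1) * (P t)\<^sup>2
      = exp ((C + 1) * t) * ((2 * A t + (C + 1)) * (P t)\<^sup>2 - 2 * (B t * (P t * Q t)))"
      by (simp add: algebra_simps power2_eq_square)
    have n: "exp ((C + 1) * t) * ((2 * A t + (C + 1)) * (P t)\<^sup>2 - 2 * (B t * (P t * Q t))) \<le> 0"
    proof (rule mult_nonneg_nonpos)
      let ?M = "4 * t * \<bar>u x\<bar> + 2 * \<bar>deriv u x\<bar>"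
      have "\<bar>B t\<bar> \<le> ?M"
        using abs_triangle_ineq[of "4 * t * u x" "2 * deriv u x"] t by (simp add: B_def abs_mult)
      then have "\<bar>B t * (P t * Q t)\<bar> \<le> ?M * (\<bar>P t\<bar> * \<bar>P t\<bar>)"
        unfolding abs_mult using QP[OF t(2)] t(2) by (intro mult_mono) auto
      then have "- (B t * (P t * Q t)) \<le> ?M * (P t)\<^sup>2"
        by (simp add: power2_eq_square)
      moreover have "(2 * A t + 2 * ?M + (C + 1)) * (P t)\<^sup>2 \<le> 0"
        using W[OF t(1)] by (intro mult_nonpos_nonneg) auto
      ultimately show "(2 * A t + (C + 1)) * (P t)\<^sup>2 - 2 * (B t * (P t * Q t)) \<le> 0"
        by (simp add: algebra_simps)
    qed simp
    show "\<exists>y. (?f has_real_derivative y) (at t) \<and> y \<le> 0"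
      using d n unfolding e by blast
  qed
  then have f_le: "(P w)\<^sup>2 * exp (C * w) \<le> ?f W0 * exp (- w)" if "W0 \<le> w" for w
  proof -
    have "exp (C * w) = exp ((C + 1) * w) * exp (- w)"
      unfolding mult_exp_exp by (simp add: algebra_simps)
    then have "(P w)\<^sup>2 * exp (C * w) = ?f w * exp (- w)"
      by (simp only: mult.assoc)
    also have "\<dots> \<le> ?f W0 * exp (- w)"
      using \<open>W0 \<le> w \<Longrightarrow> ?f w \<le> ?f W0\<close> that by (intro mult_right_mono) auto
    finally show ?thesis .
  qed
  show ?thesis
  proof (rule Lim_null_comparison)
    show "\<forall>\<^sub>F w in at_top. norm (((S k w x)\<^sup>2 + (D k w x)\<^sup>2) * exp (C * w)) \<le> ?f W0 * exp (- w)"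
      using eventually_ge_at_top[of W0]
    proof eventually_elim
      case (elim w)
      then have "0 \<le> w" by (simp add: W0_def)
      have "(S k w x)\<^sup>2 + (D k w x)\<^sup>2 = ((P w)\<^sup>2 + (Q w)\<^sup>2) / 2"
        by (simp add: P_def Q_def algebra_simps power2_eq_square)
      moreover have "(Q w)\<^sup>2 \<le> (P w)\<^sup>2"
        using QP[OF \<open>0 \<le> w\<close>] by (simp add: abs_le_square_iff)
      ultimately have "(S k w x)\<^sup>2 + (D k w x)\<^sup>2 \<le> (P w)\<^sup>2" by simp
      then have "((S k w x)\<^sup>2 + (D k w x)\<^sup>2) * exp (C * w) \<le> (P w)\<^sup>2 * exp (C * w)"
        by (intro mult_right_mono) auto
      also note f_le[OF elim]
      finally show ?case by simp
    qed
    have "((\<lambda>w::real. exp (- w)) \<longlongrightarrow> 0) at_top" by real_asymp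
    from tendsto_mult[OF tendsto_const this] show "((\<lambda>w. ?f W0 * exp (- w)) \<longlongrightarrow> 0) at_top"
      by simp
  qed
qed

lemma nonneg_section_tendsto_0:
  assumes nonneg: "\<And>w. 0 \<le> w \<Longrightarrow> 0 \<le> S k w x0 * D k w x0" and "x0 \<le> x"
  shows "((\<lambda>w. S k w x) \<longlongrightarrow> 0) at_top" "((\<lambda>w. D k w x) \<longlongrightarrow> 0) at_top"
proof -
  have "compact (u ` {x0..x})"
    by (rule compact_continuous_image[OF cont_u]) simp
  then obtain M where M: "\<And>t. \<lbrakk>x0 \<le> t; t \<le> x\<rbrakk> \<Longrightarrow> \<bar>u t\<bar> \<le> M"
    using compact_imp_bounded by (force simp: bounded_iff)
  let ?N = "\<lambda>w t. (S k w t)\<^sup>2 + (D k w t)\<^sup>2"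
  let ?C = "2 * (x - x0)"
  have "((\<lambda>w. ?N w x) \<longlongrightarrow> 0) at_top"
  proof (rule Lim_null_comparison)
    show "\<forall>\<^sub>F w in at_top. norm (?N w x) \<le> ?N w x0 * exp (?C * w) * exp (?C * M)"
      using eventually_ge_at_top[of 0]
    proof eventually_elim
      case (elim w)
      have "exp (2 * (w + M) * (x - x0)) = exp (?C * w) * exp (?C * M)"
        by (simp add: algebra_simps flip: exp_add)
      with section_norm_growth[OF \<open>x0 \<le> x\<close> elim M, of k] show ?case
        by (simp add: mult.assoc)
    qed
    show "((\<lambda>w. ?N w x0 * exp (?C * w) * exp (?C * M)) \<longlongrightarrow> 0) at_top"
      using tendsto_mult[OF nonneg_section_decay[OF nonneg] tendsto_const] by simp
  qed
  then have "((\<lambda>w. sqrt (?N w x)) \<longlongrightarrow> 0) at_top"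
    using tendsto_real_sqrt by fastforce
  then show "((\<lambda>w. S k w x) \<longlongrightarrow> 0) at_top" "((\<lambda>w. D k w x) \<longlongrightarrow> 0) at_top"
    by (rule Lim_null_comparison[rotated]; simp add: real_le_rsqrt)+
qed

end

section \<open>Positivity\<close>

locale hastings_mcleod_lax = hastings_mcleod_solution u + painleve_lax u U
  for u U :: "real \<Rightarrow> real"
begin

text \<open>Eventually u' >= sqrt x |u| >= - u, so U + u is nondecreasing, and U exceeds U + u
  because u < 0.\<close>

lemma U_bounded_below: "\<exists>c. \<forall>\<^sub>F x in at_top. c \<le> U x"
proof -
  obtain X where X: "\<And>x. X \<le> x \<Longrightarrow> sqrt x * - u x \<le> deriv u x \<and> u x < 0 \<and> 1 \<le> x"
    using eventually_conj[OF u_du_le eventually_conj[OF u_neg eventually_ge_at_top[of 1]]]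
    by (auto simp: eventually_at_top_linorder)
  have "U X + u X \<le> U x" if "X \<le> x" for x
  proof -
    have "U X + u X \<le> U x + u x"
    proof (rule DERIV_nonneg_imp_nondecreasing[OF that])
      fix t assume t: "X \<le> t" "t \<le> x"
      have "1 \<le> sqrt t" "0 \<le> - u t" using X[OF t(1)] by auto
      then have "1 * - u t \<le> sqrt t * - u t" by (rule mult_right_mono)
      then have "0 \<le> u t + deriv u t" using X[OF t(1)] by linarith
      then show "\<exists>y. ((\<lambda>t. U t + u t) has_real_derivative y) (at t) \<and> 0 \<le> y"
        using DERIV_add[OF antiderivative DERIV_u] by blast
    qed
    then show ?thesis using X[OF that] by linarith
  qed
  then show ?thesis
    by (auto simp: eventually_at_top_linorder)
qed

lemma smallness_tendsto_0:
  "((\<lambda>b. (\<bar>u (b ^ 4)\<bar> + \<bar>deriv u (b ^ 4)\<bar>) * (1 + sqrt 3 / 2 * b\<^sup>2)\<^sup>2) \<longlongrightarrow> 0) at_top"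
proof (rule Lim_null_comparison)
  have "\<forall>\<^sub>F x in at_top. \<bar>u x\<bar> + \<bar>deriv u x\<bar> \<le> exp (- x) + exp (1 - x)"
    using u_le_exp du_pos_and_decay by eventually_elim simp
  then have "\<forall>\<^sub>F b in at_top. \<bar>u (b ^ 4)\<bar> + \<bar>deriv u (b ^ 4)\<bar> \<le> exp (- (b ^ 4)) + exp (1 - b ^ 4)"
    by (subst (asm) eventually_at_top_pow4)
  then show "\<forall>\<^sub>F b in at_top. norm ((\<bar>u (b ^ 4)\<bar> + \<bar>deriv u (b ^ 4)\<bar>) * (1 + sqrt 3 / 2 * b\<^sup>2)\<^sup>2)
      \<le> (exp (- (b ^ 4)) + exp (1 - b ^ 4)) * (1 + sqrt 3 / 2 * b\<^sup>2)\<^sup>2"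
    by eventually_elim (simp add: abs_mult mult_right_mono)
  show "((\<lambda>b::real. (exp (- (b ^ 4)) + exp (1 - b ^ 4)) * (1 + sqrt 3 / 2 * b\<^sup>2)\<^sup>2) \<longlongrightarrow> 0) at_top"
    by real_asymp
qed

text \<open>Two bounds on S / D at w = 0 collide: its exact value stays above
  \<open>\<sigma>\<close>, while \<open>head_bound\<close> puts its modulus below
  \<open>?d b\<close>, which tends to 0. A single large b gives the contradiction.\<close>

lemma Y_not_both_nonpos:
  assumes Y: "Y 1 x0 \<le> 0" "Y (- 1) x0 \<le> 0"
  shows False
proof -
  obtain k where k: "0 < k 1 * k (- 1)" and nonneg: "\<And>w. 0 \<le> w \<Longrightarrow> 0 \<le> S k w x0 * D k w x0"
    using exists_nonneg_section[OF Y] by blast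
  obtain c where c: "\<forall>\<^sub>F x in at_top. c \<le> U x"
    using U_bounded_below by blast
  define \<sigma> where "\<sigma> = k 1 / k (- 1) * exp (2 * c)"
  have k0: "k 1 \<noteq> 0" "k (- 1) \<noteq> 0" "0 < k 1 / k (- 1)"
    using k by (auto simp: zero_less_mult_iff zero_less_divide_iff)
  then have "0 < \<sigma>"
    unfolding \<sigma>_def by (intro mult_pos_pos) auto
  let ?I = "\<lambda>b. integral {0..sqrt 3 / 2 * b\<^sup>2}
      (\<lambda>w. (2 * deriv u (b ^ 4) - 4 * w * u (b ^ 4)) * exp (2 * b ^ 4 * w - 8 * w ^ 3 / 3))"
  let ?m = "\<lambda>b. (\<bar>u (b ^ 4)\<bar> + \<bar>deriv u (b ^ 4)\<bar>) * (1 + sqrt 3 / 2 * b\<^sup>2)\<^sup>2"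
  let ?d = "\<lambda>b. \<bar>1 - ?I b\<bar> + 35 * ?m b"
  have d: "(?d \<longlongrightarrow> \<bar>1 - 1\<bar> + 35 * 0) at_top"
    by (intro tendsto_intros connection_integral_tendsto smallness_tendsto_0)
  have "\<forall>\<^sub>F b in at_top. ?d b < \<sigma>"
    using d by (rule order_tendstoD) (use \<open>0 < \<sigma>\<close> in simp)
  moreover have "\<forall>\<^sub>F b in at_top. ?m b < 1 / 100"
    using smallness_tendsto_0 by (rule order_tendstoD) simp
  moreover have "\<forall>\<^sub>F b in at_top. \<bar>1 - ?I b\<bar> < 1 / 10"
  proof -
    have "((\<lambda>b. \<bar>1 - ?I b\<bar>) \<longlongrightarrow> \<bar>1 - 1\<bar>) at_top"
      by (intro tendsto_intros connection_integral_tendsto)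
    then show ?thesis by (rule order_tendstoD) simp
  qed
  moreover have "\<forall>\<^sub>F b in at_top. u (b ^ 4) < 0 \<and> 0 < deriv u (b ^ 4) \<and> x0 \<le> b ^ 4 \<and> c \<le> U (b ^ 4)"
  proof -
    have "\<forall>\<^sub>F x in at_top. u x < 0 \<and> 0 < deriv u x \<and> x0 \<le> x \<and> c \<le> U x"
      using u_neg du_pos_and_decay eventually_ge_at_top[of x0] c by eventually_elim simp
    then show ?thesis by (subst (asm) eventually_at_top_pow4)
  qed
  ultimately have "\<forall>\<^sub>F b in at_top. ?d b < \<sigma> \<and> ?m b < 1 / 100 \<and> \<bar>1 - ?I b\<bar> < 1 / 10 \<and> 2 \<le> b
      \<and> u (b ^ 4) < 0 \<and> 0 < deriv u (b ^ 4) \<and> x0 \<le> b ^ 4 \<and> c \<le> U (b ^ 4)"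
    using eventually_ge_at_top[of 2] by eventually_elim blast
  from eventually_happens[OF this] obtain b where b: "?d b < \<sigma>" "?m b < 1 / 100" "\<bar>1 - ?I b\<bar> < 1 / 10" "2 \<le> b"
      "u (b ^ 4) < 0" "0 < deriv u (b ^ 4)" "x0 \<le> b ^ 4" "c \<le> U (b ^ 4)"
    by auto
  define x where "x = b ^ 4"
  \<comment> \<open>With this normalisation p + q = S and p - q = D, so \<open>head_bound\<close>
    compares S with D at w = 0.\<close>
  define p where "p w = (S k w x + D k w x) / 2" for w
  define q where "q w = (S k w x - D k w x) / 2" for w
  have lims: "((\<lambda>w. S k w x) \<longlongrightarrow> 0) at_top" "((\<lambda>w. D k w x) \<longlongrightarrow> 0) at_top"
    using nonneg_section_tendsto_0[OF nonneg] b(7) by (auto simp: x_def)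
  interpret lax_ode x "u x" "deriv u x" p q
  proof
    fix w
    show "(p has_real_derivative (x + 2 * (u x)\<^sup>2 - 4 * w\<^sup>2) * p w - (4 * w * u x + 2 * deriv u x) * q w) (at w)"
      unfolding p_def
      by (rule DERIV_cong[OF DERIV_cdivide[OF DERIV_add[OF DERIV_S DERIV_D]]])
        (simp add: q_def Y_def field_simps)
    show "(q has_real_derivative (2 * deriv u x - 4 * w * u x) * p w - (x + 2 * (u x)\<^sup>2 - 4 * w\<^sup>2) * q w) (at w)"
      unfolding q_def
      by (rule DERIV_cong[OF DERIV_cdivide[OF DERIV_diff[OF DERIV_S DERIV_D]]])
        (simp add: p_def Y_def field_simps)
  next
    show "(p \<longlongrightarrow> 0) at_top" "(q \<longlongrightarrow> 0) at_top"
      unfolding p_def q_def using lims by (auto intro!: tendsto_eq_intros)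
  qed
  have "\<bar>p 0 + q 0\<bar> \<le> ?d b * \<bar>p 0 - q 0\<bar>"
    by (rule head_bound[OF x_def b(4) refl]) (use b in \<open>simp_all add: x_def\<close>)
  then have "\<bar>S k 0 x\<bar> \<le> ?d b * \<bar>D k 0 x\<bar>"
    by (simp add: p_def q_def field_simps)
  also have "\<dots> < \<sigma> * \<bar>D k 0 x\<bar>"
    using b(1) k0 by (intro mult_strict_right_mono) (auto simp: lax_0)
  also have "\<dots> \<le> (k 1 / k (- 1) * exp (2 * U x)) * \<bar>D k 0 x\<bar>"
  proof (rule mult_right_mono)
    show "\<sigma> \<le> k 1 / k (- 1) * exp (2 * U x)"
      unfolding \<sigma>_def using b(8) k0(3) by (intro mult_left_mono) (auto simp: x_def)
  qed simp
  also have "\<dots> = \<bar>S k 0 x\<bar>"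
  proof -
    have "exp (2 * U x) * exp (- U x) = exp (U x)"
      unfolding mult_exp_exp by simp
    moreover have "k 1 / k (- 1) * \<bar>k (- 1)\<bar> = \<bar>k 1\<bar>"
      using k k0 by (auto simp: zero_less_mult_iff abs_if)
    moreover have "(k 1 / k (- 1) * exp (2 * U x)) * \<bar>D k 0 x\<bar>
        = (k 1 / k (- 1) * \<bar>k (- 1)\<bar>) * (exp (2 * U x) * exp (- U x))"
      by (simp add: lax_0 abs_mult)
    ultimately show ?thesis
      by (simp only: lax_0 abs_mult abs_exp_cancel mult_1)
  qed
  finally show False by simp
qed

lemma du_pos: "0 < deriv u x"
proof (rule ccontr)
  assume not_pos: "\<not> 0 < deriv u x"
  obtain X where X: "\<And>x. X \<le> x \<Longrightarrow> 0 < deriv u x \<and> u x < 0"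
    using eventually_conj[OF du_pos_and_decay u_neg] by (auto simp: eventually_at_top_linorder)
  \<comment> \<open>Beyond \<open>X\<close> the derivative is positive, so cutting there loses no
    candidate and makes the set compact; its maximum is the last point with u' <= 0.\<close>
  define A where "A = {x..X} \<inter> {t. deriv u t \<le> 0}"
  have "x \<le> X"
    using X[of x] not_pos by linarith
  with not_pos have "A \<noteq> {}" by (auto simp: A_def)
  moreover have "compact A"
    unfolding A_def by (intro compact_Int_closed compact_Icc closed_Collect_le cont_du continuous_on_const)
  ultimately obtain z where zA: "z \<in> A" "\<And>t. t \<in> A \<Longrightarrow> t \<le> z"
    using compact_attains_sup[of A] by blast
  then have z: "x \<le> z" "z \<le> X" "deriv u z \<le> 0"
    by (simp_all add: A_def)
  have right: "0 < deriv u t" if "z < t" for t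
  proof (rule ccontr)
    assume t: "\<not> 0 < deriv u t"
    then have "t < X" using X[of t] by linarith
    with t z that have "t \<in> A" by (simp add: A_def)
    with zA(2) that show False by fastforce
  qed
  have "(deriv u \<longlongrightarrow> deriv u z) (at_right z)"
    using DERIV_isCont[OF DERIV_du] by (auto simp: isCont_def intro: tendsto_mono[OF at_le])
  moreover have "\<forall>\<^sub>F t in at_right z. 0 \<le> deriv u t"
    using right by (auto simp: eventually_at_filter less_imp_le)
  ultimately have "0 \<le> deriv u z"
    by (rule tendsto_lowerbound) simp
  with z(3) have du_z: "deriv u z = 0" by simp
  have second: "0 \<le> 2 * u z ^ 3 + z * u z"
  proof (rule ccontr)
    assume "\<not> ?thesis"
    then obtain d where d: "0 < d" "\<And>h. \<lbrakk>0 < h; h < d\<rbrakk> \<Longrightarrow> deriv u (z + h) < deriv u z"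
      using DERIV_neg_dec_right[OF DERIV_du, of z] by auto
    from d(2)[of "d / 2"] d(1) right[of "z + d / 2"] du_z show False by simp
  qed
  have "u z \<le> u X"
  proof (rule DERIV_nonneg_imp_nondecreasing[where f = u])
    show "z \<le> X" by (rule z(2))
    show "\<exists>y. (u has_real_derivative y) (at t) \<and> 0 \<le> y" if "z \<le> t" for t
      using DERIV_u[of t] right[of t] du_z that by (cases "t = z") (auto intro: less_imp_le)
  qed
  then have "u z < 0" using X[of X] by simp
  moreover have "0 \<le> u z * (z + 2 * (u z)\<^sup>2)"
    using second by (simp add: power2_eq_square power3_eq_cube algebra_simps)
  ultimately have "z + 2 * (u z)\<^sup>2 \<le> 0"
    by (simp add: zero_le_mult_iff)
  then show False
    using Y_not_both_nonpos[of z] by (simp add: Y_def du_z)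
qed

lemma u_negative: "u x < 0"
proof -
  obtain X where X: "\<And>x. X \<le> x \<Longrightarrow> u x < 0"
    using u_neg by (auto simp: eventually_at_top_linorder)
  have "u x \<le> u (max x X)"
    by (rule DERIV_nonneg_imp_nondecreasing[where f = u]) (use DERIV_u du_pos less_imp_le in \<open>simp, blast\<close>)
  with X[of "max x X"] show ?thesis by simp
qed

lemma TW_y_pos: "0 < TW_y u x"
proof (rule ccontr)
  assume "\<not> 0 < TW_y u x"
  then have "Y 1 x \<le> 0"
    by (simp add: TW_y_def Y_def)
  moreover from this have "Y (- 1) x \<le> 0"
    using du_pos[of x] by (simp add: Y_def)
  ultimately show False
    by (rule Y_not_both_nonpos)
qed

end

section \<open>The sign of v and the conclusion\<close>

context hastings_mcleod_solution
begin

text \<open>Identifies v with \<open>- energy\<close>, so that its sign follows from the monotone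
  decrease of \<open>energy\<close> to 0.\<close>

lemma integral_u_squared: "integral {x..} (\<lambda>s. (u s)\<^sup>2) = energy x"
proof (rule integral_unique, rule has_integral_improper)
  show "isCont (\<lambda>s. (u s)\<^sup>2) s" for s
    using DERIV_isCont[OF DERIV_u] by (intro continuous_intros)
  have "((\<lambda>R. energy x - energy R) \<longlongrightarrow> energy x - 0) at_top"
    by (intro tendsto_intros energy_tendsto_0)
  moreover have "\<forall>\<^sub>F R in at_top. energy x - energy R = integral {x..R} (\<lambda>s. (u s)\<^sup>2)"
    using eventually_ge_at_top[of x]
  proof eventually_elim
    case (elim R)
    have "((\<lambda>s. - energy s) has_real_derivative (u s)\<^sup>2) (at s)" for s
      using DERIV_minus[OF DERIV_energy[of s]] by simp
    from integral_unique[OF has_integral_of_DERIV[OF elim this]] show ?case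
      by simp
  qed
  ultimately show "((\<lambda>R. integral {x..R} (\<lambda>s. (u s)\<^sup>2)) \<longlongrightarrow> energy x) at_top"
    by (simp add: tendsto_cong)
qed

end

lemma (in hastings_mcleod_lax) TW_v_neg: "TW_v u x < 0"
proof -
  have "0 < energy x"
  proof (rule DERIV_neg_imp_decreasing_at_top[OF _ energy_tendsto_0])
    show "\<exists>y. (energy has_real_derivative y) (at t) \<and> y < 0" for t
      using DERIV_energy[of t] u_negative[of t] by (intro exI[of _ "- ((u t)\<^sup>2)"]) simp
  qed
  then show ?thesis
    by (simp add: TW_v_def integral_u_squared)
qed

theorem mainTheorem6:
  fixes u :: "real \<Rightarrow> real" and r :: real
  assumes "hastings_mcleod u"
  shows "F_GOE u r ^ 4 < F_stat0 u r * F_GUE u r"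
proof -
  interpret hm: hastings_mcleod_solution u
    by unfold_locales (rule assms)
  obtain U where "\<And>x. (U has_real_derivative u x) (at x)"
    using antiderivative_exists[OF hm.cont_u] by blast
  then interpret hastings_mcleod_lax u U
    by unfold_locales
  \<comment> \<open>Both sides of the claim are multiples of this factor, by 1 and by 1 - y
    v.\<close>
  let ?c = "(TW_E u r * TW_F u r) ^ 4"
  have "TW_y u r * TW_v u r < 0"
    using TW_y_pos TW_v_neg by (rule mult_pos_neg)
  moreover have "0 < ?c"
    by (simp add: TW_E_def TW_F_def)
  ultimately have "1 * ?c < (1 - TW_y u r * TW_v u r) * ?c"
    by (intro mult_strict_right_mono) simp_all
  then show ?thesis
    by (simp add: F_GOE_def F_stat0_def F_GUE_def power_mult_distrib mult.commute mult.left_commute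
        flip: power_mult power_add)
qed

end
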